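(* Let $p\in(1,\infty)$, $\alpha>0$, and let $\mu$ be a positive Borel measure on $(0,\infty)$ such that $\mu((0,1))=0$ and $\sup_{n\in\mathbb{N}}\int_{1}^{\infty}t^{-(n+1)}\,d\mu(t)<\infty$. Then the Hausdorff operator $\mathcal{H}_{\mu}$ is compact on $F^{p}_{\alpha}$ if and only if $$\lim_{n\to\infty}\int_{1}^{\infty}\frac{1}{t^{n+1}}\,d\mu(t)=0.$$
   Context: $\mathbb{N}=\{0,1,2,\dots\}$. For $1\le p<\infty$ and $\alpha>0$, the Fock space $F^p_\alpha$ is the Banach space of entire functions $f$ with $\|f\|_{p,\alpha}^p=\frac{\alpha p}{2\pi}\int_{\mathbb{C}}|f(z)e^{-\frac{\alpha}{2}|z|^2}|^p\,dA(z)<\infty$, where $dA$ is Lebesgue area measure. For a positive Borel measure $\mu$ on $(0,\infty)$, the Hausdorff operator is $\mathcal{H}_{\mu}(f)(z)=\int_{0}^{\infty}\frac{1}{t}f\left(\frac{z}{t}\right)d\mu(t)$, $z\in\mathbb{C}$. *)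

theory Defs
  imports "HOL-Analysis.Analysis"
begin

definition fock_integral :: "real \<Rightarrow> real \<Rightarrow> (complex \<Rightarrow> complex) \<Rightarrow> ennreal" where
  "fock_integral p \<alpha> f =
     (\<integral>\<^sup>+ z. ennreal ((cmod (f z) * exp (- (\<alpha> / 2) * (cmod z)\<^sup>2)) powr p) \<partial>lborel)"

definition fock_space :: "real \<Rightarrow> real \<Rightarrow> (complex \<Rightarrow> complex) set" where
  "fock_space p \<alpha> = {f. f holomorphic_on UNIV \<and> fock_integral p \<alpha> f < \<infinity>}"

definition fock_norm :: "real \<Rightarrow> real \<Rightarrow> (complex \<Rightarrow> complex) \<Rightarrow> real" where
  "fock_norm p \<alpha> f = (\<alpha> * p / (2 * pi) * enn2real (fock_integral p \<alpha> f)) powr (1 / p)"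

text \<open>Hausdorff operator; mu is a measure on the real line carried by (0,infinity).\<close>
definition hausdorff_op :: "real measure \<Rightarrow> (complex \<Rightarrow> complex) \<Rightarrow> complex \<Rightarrow> complex" where
  "hausdorff_op \<mu> f z = (\<integral> t. f (z / complex_of_real t) / complex_of_real t \<partial>\<mu>)"

definition compact_on_fock ::
  "real \<Rightarrow> real \<Rightarrow> ((complex \<Rightarrow> complex) \<Rightarrow> (complex \<Rightarrow> complex)) \<Rightarrow> bool" where
  "compact_on_fock p \<alpha> T \<longleftrightarrow>
     (\<forall>f\<in>fock_space p \<alpha>. T f \<in> fock_space p \<alpha>) \<and>
     (\<forall>fs :: nat \<Rightarrow> complex \<Rightarrow> complex. \<forall>M.
        (\<forall>n. fs n \<in> fock_space p \<alpha> \<and> fock_norm p \<alpha> (fs n) \<le> M) \<longrightarrow>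
        (\<exists>r g. strict_mono r \<and> g \<in> fock_space p \<alpha> \<and>
           (\<lambda>n. fock_norm p \<alpha> (\<lambda>z. T (fs (r n)) z - g z)) \<longlonglongrightarrow> 0))"

end

theory Submission
  imports Defs "HOL-Complex_Analysis.Complex_Analysis" "HOL-Probability.Distributions"
begin

text \<open>
  Put \<open>dN(t) = t\<^sup>-\<^sup>1 d\<mu>(t)\<close> on \<open>[1, \<infinity>)\<close>. The hypotheses make \<open>N\<close> a finite measure, the operator becomes
  \<open>f \<mapsto> (z \<mapsto> \<integral> f(z/t) dN(t))\<close>, and the moments decrease to \<open>N{1}\<close>, so compactness has to be
  characterised by \<open>N{1} = 0\<close>.

  If \<open>N{1} = 0\<close>, Montel's theorem and Fatou's lemma reduce compactness to bounded sequences that tend to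
  \<open>0\<close> pointwise. The part of the operator over \<open>t < s\<close> has norm \<open>O(N[1,s))\<close>, which is small for \<open>s\<close> near \<open>1\<close>.
  Over \<open>t \<ge> s > 1\<close>, the pointwise bound \<open>|f(w)| \<le> K exp(\<alpha>(|w|+1)\<^sup>2/2)\<close> gives an integrable majorant of
  \<open>f(z/t)\<close>, and dominated convergence applies.

  Conversely, the normalised monomials are eigenvectors with eigenvalues at least \<open>N{1}\<close>, and a
  rotation argument shows that they are uniformly separated.
\<close>

section \<open>Lebesgue measure on the complex plane\<close>

text \<open>The obstruction sits at \<open>t = 1\<close>. There the dilation is the identity, and
  the pointwise bound, whose radius is enlarged by 1, outgrows what the Gaussian weight can absorb,
  so it yields no integrable majorant. For \<open>t\<close> at least \<open>s > 1\<close> the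
  quadratic exponent shrinks by the factor \<open>1 / s\<^sup>2\<close>, which leaves a Gaussian to
  spare. The norm estimate for a single dilation behaves the other way: its constant grows with
  \<open>t\<close>, and \<open>N\<close> is only known to be finite, so that estimate serves bounded
  \<open>t\<close> only. Hence the cut at \<open>s\<close>, with a different estimate on each side.
  Only smallness and strict positivity ever matter. All estimates are therefore made for the p-th
  power integrals, with crude factors \<open>2 powr p\<close> in place of the sharp Minkowski and
  Hoelder constants. The enlargement by 1 is the radius of the disc over which the mean value
  property is averaged. Passing from circles to discs needs rotation invariance of planar Lebesgue
  measure, which also drives the separation of the monomials; it is derived from Fubini in real and
  imaginary part by factoring rotations into shears.\<close>

lemma measurable_Complex [measurable]:
  "(\<lambda>(x, y). Complex x y) \<in> borel_measurable (borel \<Otimes>\<^sub>M borel)"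
  unfolding borel_prod by (intro borel_measurable_continuous_onI)
    (auto simp: split_def Complex_eq intro!: continuous_intros)

text \<open>Lebesgue measure is determined by its values on boxes, and the preimage of a box is a
  rectangle. This makes Tonelli in real and imaginary part available.\<close>

lemma lborel_complex_eq_distr:
  "(lborel :: complex measure) = distr (lborel \<Otimes>\<^sub>M lborel) borel (\<lambda>(x, y). Complex x y)"
proof (rule lborel_eqI)
  fix l u :: complex
  assume le: "\<And>b. b \<in> Basis \<Longrightarrow> l \<bullet> b \<le> u \<bullet> b"
  then have le': "Re l \<le> Re u" "Im l \<le> Im u"
    by (force simp: Basis_complex_def)+
  have "(\<lambda>(x, y). Complex x y) -` box l u \<inter> space (lborel \<Otimes>\<^sub>M lborel)
      = {Re l<..<Re u} \<times> {Im l<..<Im u}"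
    by (auto simp: box_def Basis_complex_def space_pair_measure)
  moreover have "(\<lambda>(x, y). Complex x y) \<in> borel_measurable (lborel \<Otimes>\<^sub>M lborel)"
    by measurable
  ultimately have "emeasure (distr (lborel \<Otimes>\<^sub>M lborel) borel (\<lambda>(x, y). Complex x y)) (box l u)
      = emeasure (lborel \<Otimes>\<^sub>M lborel) ({Re l<..<Re u} \<times> {Im l<..<Im u})"
    by (simp add: emeasure_distr)
  also have "\<dots> = ennreal (Re u - Re l) * ennreal (Im u - Im l)"
    using le' by (subst lborel.emeasure_pair_measure_Times) auto
  also have "\<dots> = (\<Prod>b\<in>Basis. (u - l) \<bullet> b)"
    using le' by (simp add: Basis_complex_def ennreal_mult)
  finally show "emeasure (distr (lborel \<Otimes>\<^sub>M lborel) borel (\<lambda>(x, y). Complex x y)) (box l u)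
      = ennreal (\<Prod>b\<in>Basis. (u - l) \<bullet> b)" .
qed simp

lemma
  assumes [measurable]: "f \<in> borel_measurable borel"
  shows nn_integral_complex_Re_Im: "(\<integral>\<^sup>+z. f z \<partial>lborel) = (\<integral>\<^sup>+x. \<integral>\<^sup>+y. f (Complex x y) \<partial>lborel \<partial>lborel)"
    and nn_integral_complex_Im_Re: "(\<integral>\<^sup>+z. f z \<partial>lborel) = (\<integral>\<^sup>+y. \<integral>\<^sup>+x. f (Complex x y) \<partial>lborel \<partial>lborel)"
proof -
  have [measurable]: "(\<lambda>p. f (case p of (x, y) \<Rightarrow> Complex x y)) \<in> borel_measurable (lborel \<Otimes>\<^sub>M lborel)"
    by measurable
  have *: "(\<integral>\<^sup>+z. f z \<partial>lborel) = (\<integral>\<^sup>+p. f (case p of (x, y) \<Rightarrow> Complex x y) \<partial>(lborel \<Otimes>\<^sub>M lborel))"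
    by (subst lborel_complex_eq_distr, subst nn_integral_distr) auto
  show "(\<integral>\<^sup>+z. f z \<partial>lborel) = (\<integral>\<^sup>+x. \<integral>\<^sup>+y. f (Complex x y) \<partial>lborel \<partial>lborel)"
    unfolding * by (subst lborel.nn_integral_fst[symmetric]) auto
  show "(\<integral>\<^sup>+z. f z \<partial>lborel) = (\<integral>\<^sup>+y. \<integral>\<^sup>+x. f (Complex x y) \<partial>lborel \<partial>lborel)"
    unfolding * by (subst lborel_pair.nn_integral_snd[symmetric]) auto
qed

lemma measurable_Complex_linear [measurable]:
  "(\<lambda>z. Complex (a * Re z + b * Im z) (c * Re z + d * Im z)) \<in> borel_measurable borel"
  by (intro borel_measurable_continuous_onI) (auto simp: Complex_eq intro!: continuous_intros)

text \<open>For a fixed imaginary part the shear is a translation of the real part, so it disappears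
  when the real part is integrated first.\<close>

lemma nn_integral_complex_shear_Re:
  assumes [measurable]: "f \<in> borel_measurable borel"
  shows "(\<integral>\<^sup>+z. f (Complex (Re z + a * Im z) (Im z)) \<partial>lborel) = (\<integral>\<^sup>+z. f z \<partial>lborel)"
proof -
  have [measurable]: "(\<lambda>z. f (Complex (Re z + a * Im z) (Im z))) \<in> borel_measurable borel"
    using measurable_compose[OF measurable_Complex_linear[of 1 a 0 1] assms] by simp
  have [measurable]: "(\<lambda>x. f (Complex x y)) \<in> borel_measurable borel" for y
    by (rule measurable_compose[OF _ assms], intro borel_measurable_continuous_onI)
      (auto simp: Complex_eq intro!: continuous_intros)
  have "(\<integral>\<^sup>+x. f (Complex (x + a * y) y) \<partial>lborel) = (\<integral>\<^sup>+x. f (Complex x y) \<partial>lborel)" for y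
    by (subst (2) nn_integral_real_affine[where c = 1 and t = "a * y"]) (auto simp: add.commute)
  then show ?thesis
    by (simp add: nn_integral_complex_Im_Re)
qed

lemma nn_integral_complex_shear_Im:
  assumes [measurable]: "f \<in> borel_measurable borel"
  shows "(\<integral>\<^sup>+z. f (Complex (Re z) (Im z + a * Re z)) \<partial>lborel) = (\<integral>\<^sup>+z. f z \<partial>lborel)"
proof -
  have [measurable]: "(\<lambda>z. f (Complex (Re z) (Im z + a * Re z))) \<in> borel_measurable borel"
    using measurable_compose[OF measurable_Complex_linear[of 1 0 a 1] assms] by (simp add: add.commute)
  have [measurable]: "(\<lambda>y. f (Complex x y)) \<in> borel_measurable borel" for x
    by (rule measurable_compose[OF _ assms], intro borel_measurable_continuous_onI)
      (auto simp: Complex_eq intro!: continuous_intros)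
  have "(\<integral>\<^sup>+y. f (Complex x (y + a * x)) \<partial>lborel) = (\<integral>\<^sup>+y. f (Complex x y) \<partial>lborel)" for x
    by (subst (2) nn_integral_real_affine[where c = 1 and t = "a * x"]) (auto simp: add.commute)
  then show ?thesis
    by (simp add: nn_integral_complex_Re_Im)
qed

text \<open>A rotation other than the half turn is a product of three shears, horizontal, vertical,
  horizontal, and each of them preserves the integral.\<close>

lemma nn_integral_complex_rotate:
  assumes f: "f \<in> borel_measurable borel" and u: "cmod u = 1"
  shows "(\<integral>\<^sup>+z. f (u * z) \<partial>lborel) = (\<integral>\<^sup>+z. f z \<partial>lborel)"
proof -
  have *: "(\<integral>\<^sup>+z. f (u * z) \<partial>lborel) = (\<integral>\<^sup>+z. f z \<partial>lborel)"
    if f: "f \<in> borel_measurable borel" and u: "cmod u = 1" "Re u \<noteq> -1" for f :: "complex \<Rightarrow> ennreal" and u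
  proof -
    \<comment> \<open>For \<open>u = cis x\<close> this is minus the tangent of
      \<open>x / 2\<close>, and \<open>b\<close> is the sine of \<open>x\<close>: the classical
      shear factors of a rotation. The tangent is undefined exactly at the half turn.\<close>
    define a where "a = - Im u / (1 + Re u)"
    define b where "b = Im u"
    have nz: "1 + Re u \<noteq> 0"
      using u by linarith
    have sq: "(Re u)\<^sup>2 + (Im u)\<^sup>2 = 1"
      using u by (simp add: cmod_power2[symmetric])
    have ab: "1 + a * b = Re u" "2 * a + a * a * b = - Im u"
    proof -
      have a: "a * (1 + Re u) = - Im u"
        using nz by (simp add: a_def)
      have "a * b * (1 + Re u) = (Re u - 1) * (1 + Re u)"
        using a sq unfolding b_def by algebra
      then have "a * b = Re u - 1"
        using nz by simp
      then show "1 + a * b = Re u" "2 * a + a * a * b = - Im u"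
        using a by algebra+
    qed
    define g where "g = (\<lambda>z. f (Complex (Re z + a * Im z) (Im z)))"
    define h where "h = (\<lambda>z. g (Complex (Re z) (Im z + b * Re z)))"
    have g: "g \<in> borel_measurable borel"
      using measurable_compose[OF measurable_Complex_linear[of 1 a 0 1] f] by (simp add: g_def)
    have h: "h \<in> borel_measurable borel"
      using measurable_compose[OF measurable_Complex_linear[of 1 0 b 1] g] by (simp add: h_def add.commute)
    have "u * z = Complex (Re z + a * Im z + a * (Im z + b * (Re z + a * Im z))) (Im z + b * (Re z + a * Im z))" for z
    proof -
      have 1: "Re z + a * Im z + a * (Im z + b * (Re z + a * Im z))
          = (1 + a * b) * Re z + (2 * a + a * a * b) * Im z"
        and 2: "Im z + b * (Re z + a * Im z) = b * Re z + (1 + a * b) * Im z"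
        by (simp_all add: algebra_simps)
      show ?thesis
        unfolding 1 unfolding 2 unfolding ab by (simp add: complex_eq_iff b_def)
    qed
    then have "(\<integral>\<^sup>+z. f (u * z) \<partial>lborel) = (\<integral>\<^sup>+z. h (Complex (Re z + a * Im z) (Im z)) \<partial>lborel)"
      by (simp add: h_def g_def)
    also have "\<dots> = (\<integral>\<^sup>+z. f z \<partial>lborel)"
      using nn_integral_complex_shear_Re[OF h] nn_integral_complex_shear_Im[OF g]
        nn_integral_complex_shear_Re[OF f] by (simp add: h_def g_def)
    finally show ?thesis .
  qed
  show ?thesis
  proof (cases "Re u = -1")
    case True
    then have "Im u = 0"
      using u by (simp add: cmod_def)
    \<comment> \<open>The excluded half turn is two quarter turns, each covered by the shear
      argument.\<close>
    with True have "u * z = \<i> * (\<i> * z)" for z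
      by (simp add: complex_eq_iff)
    moreover have "(\<lambda>z. f (\<i> * z)) \<in> borel_measurable borel"
      using f by measurable
    ultimately show ?thesis
      using *[of "\<lambda>z. f (\<i> * z)" \<i>] *[OF f, of \<i>] by simp
  qed (use * f u in blast)
qed

lemma nn_integral_complex_scale:
  assumes [measurable]: "f \<in> borel_measurable borel" and c: "c > 0"
  shows "(\<integral>\<^sup>+z. f (z / complex_of_real c) \<partial>lborel) = ennreal (c\<^sup>2) * (\<integral>\<^sup>+z. f z \<partial>lborel)"
proof -
  have "(\<integral>\<^sup>+z. f (z / complex_of_real c) \<partial>lborel)
      = (\<integral>\<^sup>+z. f (z / complex_of_real c) \<partial>density (distr lborel borel (\<lambda>x. 0 + c *\<^sub>R x)) (\<lambda>_. \<bar>c\<bar>^DIM(complex)))"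
    using lborel_affine[of c "0::complex"] c by simp
  also have "\<dots> = ennreal (c\<^sup>2) * (\<integral>\<^sup>+z. f z \<partial>lborel)"
    using c by (simp add: nn_integral_density nn_integral_distr nn_integral_cmult scaleR_conv_of_real)
  finally show ?thesis .
qed

lemma nn_integral_complex_gaussian_finite:
  assumes c: "c > 0"
  shows "(\<integral>\<^sup>+z. ennreal (exp (- c * (cmod z)\<^sup>2)) \<partial>lborel) < \<infinity>"
proof -
  \<comment> \<open>The standard deviation for which the normal density has exponent
    \<open>- c * x\<^sup>2\<close>.\<close>
  define s where "s = sqrt (1 / (2 * c))"
  have s: "s > 0" "s\<^sup>2 = 1 / (2 * c)"
    using c by (auto simp: s_def)
  have eq: "exp (- c * x\<^sup>2) = sqrt (2 * pi * s\<^sup>2) * normal_density 0 s x" for x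
    using c s by (simp add: normal_density_def)
  have "integrable lborel (\<lambda>x. exp (- c * x\<^sup>2))"
    unfolding eq using s by (intro integrable_mult_right integrable_normal_density)
  then obtain r where r: "(\<integral>\<^sup>+x. ennreal (exp (- c * x\<^sup>2)) \<partial>lborel) = ennreal r"
    by (subst (asm) integrable_iff_bounded) (auto simp: less_top_ennreal)
  have "(\<integral>\<^sup>+z. ennreal (exp (- c * (cmod z)\<^sup>2)) \<partial>lborel)
     = (\<integral>\<^sup>+x. \<integral>\<^sup>+y. ennreal (exp (- c * x\<^sup>2)) * ennreal (exp (- c * y\<^sup>2)) \<partial>lborel \<partial>lborel)"
    by (subst nn_integral_complex_Re_Im)
      (auto simp: cmod_power2 ennreal_mult[symmetric] exp_add[symmetric] algebra_simps)
  also have "\<dots> = ennreal r * ennreal r"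
    using r by (simp add: nn_integral_cmult nn_integral_multc)
  finally show ?thesis
    by (simp add: ennreal_mult_less_top)
qed

section \<open>Mean values of entire functions\<close>

lemma entire_has_integral_circle_mean:
  assumes "g holomorphic_on UNIV"
  shows "((\<lambda>x. g (exp (2 * of_real pi * \<i> * of_real x))) has_integral g 0) {0..1::real}"
proof -
  have "((\<lambda>u. g u / (u - 0)) has_contour_integral (2 * of_real pi * \<i> * g 0)) (circlepath 0 1)"
    using assms by (intro Cauchy_integral_circlepath holomorphic_on_imp_continuous_on)
      (auto intro: holomorphic_on_subset)
  moreover define k where "k = 2 * of_real pi * \<i>"
  ultimately have "((\<lambda>x. k * g (exp (2 * of_real pi * \<i> * of_real x))) has_integral k * g 0) {0..1}"
    unfolding has_contour_integral_def k_def
    by (elim has_integral_eq[rotated]) (simp add: vector_derivative_circlepath01 fun_cong[OF circlepath])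
  note has_integral_mult_right[OF this, of "inverse k"]
  moreover have "k \<noteq> 0"
    by (simp add: k_def)
  ultimately show ?thesis
    by (simp add: mult.assoc[symmetric])
qed

lemma entire_borel_measurable:
  assumes "f holomorphic_on UNIV"
  shows "f \<in> borel_measurable borel"
  using assms by (intro borel_measurable_continuous_onI holomorphic_on_imp_continuous_on)

lemma entire_norm_le_circle_mean:
  assumes "g holomorphic_on UNIV"
  shows "ennreal (cmod (g 0)) \<le> (\<integral>\<^sup>+x\<in>{0..1}. ennreal (cmod (g (exp (2 * of_real pi * \<i> * of_real x)))) \<partial>lborel)"
proof -
  let ?h = "\<lambda>x::real. g (exp (2 * of_real pi * \<i> * of_real x))"
  have cont: "continuous_on UNIV g"
    using assms by (rule holomorphic_on_imp_continuous_on)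
  have "continuous_on {0..1} ?h"
    by (intro continuous_on_compose2[OF cont] continuous_intros) auto
  then have int: "set_integrable lborel {0..1} ?h"
    unfolding set_integrable_def by (intro borel_integrable_compact) auto
  have "g 0 = (LINT x:{0..1}|lborel. ?h x)"
    using set_borel_integral_eq_integral(2)[OF int] entire_has_integral_circle_mean[OF assms]
    by (simp add: integral_unique)
  also have "ennreal (cmod \<dots>) \<le> (\<integral>\<^sup>+x. ennreal (cmod (indicator {0..1} x *\<^sub>R ?h x)) \<partial>lborel)"
    using int unfolding set_lebesgue_integral_def set_integrable_def
    by (rule integral_norm_bound_ennreal)
  also have "\<dots> = (\<integral>\<^sup>+x\<in>{0..1}. ennreal (cmod (?h x)) \<partial>lborel)"
    by (intro nn_integral_cong) (auto split: split_indicator)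
  finally show ?thesis .
qed

text \<open>Averaging the rotation-invariant integral over all rotations reduces the disc to circles.\<close>

lemma entire_norm_le_disc_integral:
  assumes hol: "f holomorphic_on UNIV"
  shows "ennreal (cmod (f w)) * emeasure lborel (ball (0::complex) 1)
    \<le> (\<integral>\<^sup>+z\<in>ball 0 1. ennreal (cmod (f (w + z))) \<partial>lborel)"
proof -
  let ?B = "ball (0::complex) 1"
  let ?e = "\<lambda>x::real. exp (2 * of_real pi * \<i> * of_real x) :: complex"
  have [measurable]: "f \<in> borel_measurable borel"
    by (rule entire_borel_measurable[OF hol])
  have [measurable]: "?e \<in> borel_measurable borel"
    by (intro borel_measurable_continuous_onI continuous_intros)
  have [measurable]: "?B \<in> sets borel"
    by simp
  \<comment> \<open>The circle estimate is applied to the entire function that sends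
    \<open>u\<close> to \<open>f (w + u * z)\<close>; its value at 0 is \<open>f w\<close> for every
    \<open>z\<close>.\<close>
  have mean: "ennreal (cmod (f w)) \<le> (\<integral>\<^sup>+x\<in>{0..1}. ennreal (cmod (f (w + ?e x * z))) \<partial>lborel)" for z
  proof -
    have "(\<lambda>u. f (w + u * z)) holomorphic_on UNIV"
      by (intro holomorphic_on_compose[unfolded o_def, OF _ holomorphic_on_subset[OF hol]] holomorphic_intros) auto
    from entire_norm_le_circle_mean[OF this] show ?thesis
      by simp
  qed
  have "ennreal (cmod (f w)) * emeasure lborel ?B = (\<integral>\<^sup>+z. ennreal (cmod (f w)) * indicator ?B z \<partial>lborel)"
    by (simp add: nn_integral_cmult_indicator)
  also have "\<dots> \<le> (\<integral>\<^sup>+z. (\<integral>\<^sup>+x. ennreal (cmod (f (w + ?e x * z))) * indicator {0..1} x * indicator ?B z \<partial>lborel) \<partial>lborel)"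
    using mean by (intro nn_integral_mono) (auto simp: nn_integral_multc intro!: mult_right_mono)
  also have "\<dots> = (\<integral>\<^sup>+x. (\<integral>\<^sup>+z. ennreal (cmod (f (w + ?e x * z))) * indicator {0..1} x * indicator ?B z \<partial>lborel) \<partial>lborel)"
    by (intro lborel_pair.Fubini'[symmetric]) measurable
  also have "\<dots> = (\<integral>\<^sup>+x. (\<integral>\<^sup>+z\<in>?B. ennreal (cmod (f (w + z))) \<partial>lborel) * indicator {0..1::real} x \<partial>lborel)"
  proof (intro nn_integral_cong)
    fix x :: real
    have norm: "cmod (?e x) = 1"
      using norm_exp_i_times[of "2 * pi * x"] by (simp add: mult_ac)
    have "(\<integral>\<^sup>+z. ennreal (cmod (f (w + ?e x * z))) * indicator {0..1} x * indicator ?B z \<partial>lborel)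
      = (\<integral>\<^sup>+z. (ennreal (cmod (f (w + ?e x * z))) * indicator ?B (?e x * z)) * indicator {0..1} x \<partial>lborel)"
      \<comment> \<open>The disc is rotation invariant, so its indicator may be taken at the rotated
        point; the whole integrand then is a function of \<open>?e x * z\<close>.\<close>
      by (intro nn_integral_cong) (auto simp: norm_mult norm indicator_def)
    also have "\<dots> = (\<integral>\<^sup>+z. ennreal (cmod (f (w + ?e x * z))) * indicator ?B (?e x * z) \<partial>lborel) * indicator {0..1} x"
      by (intro nn_integral_multc) measurable
    also have "\<dots> = (\<integral>\<^sup>+z\<in>?B. ennreal (cmod (f (w + z))) \<partial>lborel) * indicator {0..1} x"
      by (subst nn_integral_complex_rotate[where f = "\<lambda>z. ennreal (cmod (f (w + z))) * indicator ?B z"])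
        (auto simp: norm)
    finally show "(\<integral>\<^sup>+z. ennreal (cmod (f (w + ?e x * z))) * indicator {0..1} x * indicator ?B z \<partial>lborel)
      = (\<integral>\<^sup>+z\<in>?B. ennreal (cmod (f (w + z))) \<partial>lborel) * indicator {0..1} x" .
  qed
  also have "\<dots> = (\<integral>\<^sup>+z\<in>?B. ennreal (cmod (f (w + z))) \<partial>lborel)"
    by (subst nn_integral_cmult_indicator) auto
  finally show ?thesis .
qed

section \<open>Fock integrals\<close>

lemma fock_integral_mono:
  assumes "0 \<le> p" "\<And>z. cmod (f z) \<le> cmod (g z)"
  shows "fock_integral p \<alpha> f \<le> fock_integral p \<alpha> g"
  unfolding fock_integral_def using assms
  by (intro nn_integral_mono ennreal_leI powr_mono2 mult_right_mono) auto

text \<open>The sum is at most twice the larger term. This is the substitute for the triangle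
  inequality at the level of p-th powers.\<close>

lemma powr_add_le_two_powr:
  fixes x y :: real
  assumes "0 \<le> p" "0 \<le> x" "0 \<le> y"
  shows "(x + y) powr p \<le> 2 powr p * (x powr p + y powr p)"
proof -
  have "(x + y) powr p \<le> (2 * max x y) powr p"
    using assms by (intro powr_mono2) auto
  also have "\<dots> = 2 powr p * max x y powr p"
    using assms by (simp add: powr_mult)
  also have "\<dots> \<le> 2 powr p * (x powr p + y powr p)"
    by (intro mult_left_mono) (auto simp: max_def)
  finally show ?thesis .
qed

lemma fock_integral_add_le:
  assumes p: "0 \<le> p" and [measurable]: "f \<in> borel_measurable borel" "g \<in> borel_measurable borel"
  shows "fock_integral p \<alpha> (\<lambda>z. f z + g z)
    \<le> ennreal (2 powr p) * (fock_integral p \<alpha> f + fock_integral p \<alpha> g)"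
proof -
  let ?e = "\<lambda>z. exp (- (\<alpha> / 2) * (cmod z)\<^sup>2)"
  have "(cmod (f z + g z) * ?e z) powr p
     \<le> 2 powr p * ((cmod (f z) * ?e z) powr p + (cmod (g z) * ?e z) powr p)" for z
  proof -
    have "(cmod (f z + g z) * ?e z) powr p \<le> (cmod (f z) * ?e z + cmod (g z) * ?e z) powr p"
      using p by (intro powr_mono2) (auto simp: distrib_right[symmetric] norm_triangle_ineq)
    also have "\<dots> \<le> 2 powr p * ((cmod (f z) * ?e z) powr p + (cmod (g z) * ?e z) powr p)"
      using p by (intro powr_add_le_two_powr) auto
    finally show ?thesis .
  qed
  then have "fock_integral p \<alpha> (\<lambda>z. f z + g z) \<le> (\<integral>\<^sup>+z. ennreal (2 powr p)
      * (ennreal ((cmod (f z) * ?e z) powr p) + ennreal ((cmod (g z) * ?e z) powr p)) \<partial>lborel)"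
    unfolding fock_integral_def
    by (intro nn_integral_mono) (simp add: ennreal_mult[symmetric] ennreal_plus[symmetric] del: ennreal_plus)
  also have "\<dots> = ennreal (2 powr p) * (fock_integral p \<alpha> f + fock_integral p \<alpha> g)"
    unfolding fock_integral_def by (subst nn_integral_cmult, measurable) (simp add: nn_integral_add)
  finally show ?thesis .
qed

lemma fock_integral_diff_le:
  assumes "0 \<le> p" "f \<in> borel_measurable borel" "g \<in> borel_measurable borel"
  shows "fock_integral p \<alpha> (\<lambda>z. f z - g z)
    \<le> ennreal (2 powr p) * (fock_integral p \<alpha> f + fock_integral p \<alpha> g)"
  using fock_integral_add_le[of p f "\<lambda>z. - g z" \<alpha>] assms by (simp add: fock_integral_def)

lemma fock_integral_cmult:
  assumes [measurable]: "f \<in> borel_measurable borel"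
  shows "fock_integral p \<alpha> (\<lambda>z. c * f z) = ennreal (cmod c powr p) * fock_integral p \<alpha> f"
proof -
  have "fock_integral p \<alpha> (\<lambda>z. c * f z) = (\<integral>\<^sup>+z. ennreal (cmod c powr p) *
      ennreal ((cmod (f z) * exp (- (\<alpha> / 2) * (cmod z)\<^sup>2)) powr p) \<partial>lborel)"
    unfolding fock_integral_def
    by (intro nn_integral_cong) (simp add: norm_mult powr_mult ennreal_mult mult.assoc)
  then show ?thesis
    unfolding fock_integral_def by (subst (asm) nn_integral_cmult) auto
qed

lemma fock_integral_rotate:
  assumes [measurable]: "f \<in> borel_measurable borel" and u: "cmod u = 1"
  shows "fock_integral p \<alpha> (\<lambda>z. f (u * z)) = fock_integral p \<alpha> f"
  unfolding fock_integral_def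
  by (subst nn_integral_complex_rotate[OF _ u, symmetric]) (auto simp: norm_mult u)

lemma norm_dilate_le: "1 \<le> t \<Longrightarrow> cmod (z / of_real t) \<le> cmod z"
  using mult_left_mono[of 1 t "cmod z"] by (simp add: norm_divide field_simps)

text \<open>For \<open>t\<close> at least 1 the point \<open>z / t\<close> is nearer to the origin,
  where the weight is larger, so evaluating the weight there only increases the integrand. The
  factor \<open>t\<^sup>2\<close> is the Jacobian of the dilation of the real plane.\<close>

lemma fock_integral_dilate_le:
  assumes [measurable]: "f \<in> borel_measurable borel" and "1 \<le> t" "0 \<le> p" "0 \<le> \<alpha>"
  shows "fock_integral p \<alpha> (\<lambda>z. f (z / of_real t)) \<le> ennreal (t\<^sup>2) * fock_integral p \<alpha> f"
proof -
  have "fock_integral p \<alpha> (\<lambda>z. f (z / of_real t)) \<le>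
    (\<integral>\<^sup>+z. ennreal ((cmod (f (z / of_real t)) * exp (- (\<alpha> / 2) * (cmod (z / of_real t))\<^sup>2)) powr p) \<partial>lborel)"
    unfolding fock_integral_def using assms
    by (intro nn_integral_mono ennreal_leI powr_mono2 mult_left_mono)
      (auto intro!: mult_left_mono power_mono norm_dilate_le simp del: norm_divide)
  also have "\<dots> = ennreal (t\<^sup>2) * fock_integral p \<alpha> f"
    unfolding fock_integral_def using assms
    by (subst nn_integral_complex_scale[where f = "\<lambda>z. ennreal ((cmod (f z) * exp (- (\<alpha> / 2) * (cmod z)\<^sup>2)) powr p)"]) auto
  finally show ?thesis .
qed

section \<open>Pointwise growth, slowly growing majorants and limits\<close>

lemma nn_integral_complex_translate:
  assumes [measurable]: "f \<in> borel_measurable borel"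
  shows "(\<integral>\<^sup>+z. f (w + z) \<partial>lborel) = (\<integral>\<^sup>+z. f z \<partial>(lborel :: complex measure))"
  by (subst (2) lborel_distr_plus[of w, symmetric]) (simp add: nn_integral_distr)

text \<open>The mean over the unit disc about \<open>w\<close> controls \<open>f w\<close>. On that
  disc the weight is removed at the cost of its reciprocal at radius \<open>cmod w + 1\<close>. The
  first power is traded for the p-th by \<open>y <= 1 + y powr p\<close>, which accounts for the
  inhomogeneous summand 1; this is harmless, because the bound is used for norm-bounded
  families.\<close>

lemma fock_space_pointwise_bound:
  assumes p: "1 \<le> p" and \<alpha>: "0 < \<alpha>" and f: "f \<in> fock_space p \<alpha>"
  shows "cmod (f w) \<le> exp (\<alpha> / 2 * (cmod w + 1)\<^sup>2)
    * (1 + enn2real (fock_integral p \<alpha> f) / measure lborel (ball (0::complex) 1))"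
proof -
  let ?B = "ball (0::complex) 1" and ?L = "exp (\<alpha> / 2 * (cmod w + 1)\<^sup>2)"
  let ?y = "\<lambda>z. cmod (f z) * exp (- (\<alpha> / 2) * (cmod z)\<^sup>2)"
  define V where "V = measure lborel ?B"
  define J where "J = enn2real (fock_integral p \<alpha> f)"
  have V: "V > 0" "emeasure lborel ?B = ennreal V"
    using content_ball_pos[of 1 "0::complex"] emeasure_lborel_ball_finite[of "0::complex" 1]
    by (auto simp: V_def emeasure_eq_ennreal_measure)
  have hol: "f holomorphic_on UNIV" and fin: "fock_integral p \<alpha> f = ennreal J"
    using f by (auto simp: fock_space_def J_def)
  have J: "J \<ge> 0"
    by (simp add: J_def)
  have [measurable]: "f \<in> borel_measurable borel"
    by (rule entire_borel_measurable[OF hol])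
  have [measurable]: "?B \<in> sets borel"
    by simp
  define h where "h z = ennreal (?y (w + z) powr p)" for z
  have [measurable]: "h \<in> borel_measurable borel"
    unfolding h_def by measurable
  have le: "cmod (f (w + z)) \<le> ?L * (1 + ?y (w + z) powr p)" if "z \<in> ?B" for z
  proof -
    have y: "?y (w + z) \<le> 1 + ?y (w + z) powr p"
    proof (cases "?y (w + z) \<le> 1")
      case False
      then have "?y (w + z) powr 1 \<le> ?y (w + z) powr p"
        using p by (intro powr_mono) auto
      then show ?thesis
        using False by simp
    qed (use powr_ge_zero[of "?y (w + z)" p] in linarith)
    have "cmod (w + z) \<le> cmod w + 1"
      using that norm_triangle_ineq[of w z] by simp
    then have "exp (\<alpha> / 2 * (cmod (w + z))\<^sup>2) \<le> ?L"
      using \<alpha> by (auto intro!: mult_left_mono power_mono)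
    moreover have "cmod (f (w + z)) = exp (\<alpha> / 2 * (cmod (w + z))\<^sup>2) * ?y (w + z)"
      by (simp add: exp_minus field_simps)
    moreover have "exp (\<alpha> / 2 * (cmod (w + z))\<^sup>2) * ?y (w + z) \<le> ?L * (1 + ?y (w + z) powr p)"
      using calculation(1) y by (intro mult_mono) auto
    ultimately show ?thesis
      by linarith
  qed
  have "ennreal (cmod (f w)) * ennreal V \<le> (\<integral>\<^sup>+z\<in>?B. ennreal (cmod (f (w + z))) \<partial>lborel)"
    using entire_norm_le_disc_integral[OF hol, of w] V by simp
  also have "\<dots> \<le> (\<integral>\<^sup>+z. ennreal ?L * (indicator ?B z + h z) \<partial>lborel)"
  proof (intro nn_integral_mono)
    fix z :: complex
    show "ennreal (cmod (f (w + z))) * indicator ?B z \<le> ennreal ?L * (indicator ?B z + h z)"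
    proof (cases "z \<in> ?B")
      case True
      then have "ennreal (cmod (f (w + z))) \<le> ennreal ?L * ennreal (1 + ?y (w + z) powr p)"
        using le[OF True] by (simp add: ennreal_mult[symmetric] del: ennreal_plus)
      then show ?thesis
        using True by (simp add: h_def)
    qed simp
  qed
  also have "\<dots> = ennreal ?L * (ennreal V + (\<integral>\<^sup>+z. h z \<partial>lborel))"
    by (subst nn_integral_cmult) (simp_all add: nn_integral_add V)
  also have "(\<integral>\<^sup>+z. h z \<partial>lborel) = ennreal J"
    using fin unfolding fock_integral_def h_def
    by (subst nn_integral_complex_translate[where f = "\<lambda>z. ennreal (?y z powr p)"]) auto
  also have "ennreal ?L * (ennreal V + ennreal J) = ennreal (?L * (V + J))"
    using V J by (simp add: ennreal_mult ennreal_plus[symmetric] del: ennreal_plus)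
  finally have "cmod (f w) * V \<le> ?L * (V + J)"
    using V J by (simp add: ennreal_mult[symmetric])
  then show ?thesis
    using V by (simp add: V_def[symmetric] J_def[symmetric] field_simps)
qed

text \<open>Since \<open>s > 1\<close>, this growth is strictly slower than the Gaussian weight decays.\<close>

lemma fock_integral_slow_growth_finite:
  assumes p: "0 < p" and \<alpha>: "0 < \<alpha>" and s: "1 < s"
  shows "fock_integral p \<alpha> (\<lambda>z. of_real (K * exp (\<alpha> / 2 * (cmod z / s + 1)\<^sup>2))) < \<infinity>"
proof -
  \<comment> \<open>The weight exceeds the growth by \<open>1 - 1 / s\<^sup>2 = 2 * \<kappa>\<close>
    in the quadratic coefficient. One half absorbs the cross term \<open>2 * cmod z / s\<close>, the
    other remains as a Gaussian.\<close>
  define \<kappa> where "\<kappa> = (1 - 1 / s\<^sup>2) / 2"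
  have \<kappa>: "\<kappa> > 0"
    using s by (simp add: \<kappa>_def field_simps one_less_power)
  define c where "c = p * \<alpha> / 2 * \<kappa>"
  have c: "c > 0"
    using p \<alpha> \<kappa> by (simp add: c_def)
  define C where "C = (\<bar>K\<bar> * exp (\<alpha> / 2 * (1 + 1 / (\<kappa> * s\<^sup>2)))) powr p"
  have le: "(cmod (of_real (K * exp (\<alpha> / 2 * (cmod z / s + 1)\<^sup>2))) * exp (- (\<alpha> / 2) * (cmod z)\<^sup>2)) powr p
      \<le> C * exp (- c * (cmod z)\<^sup>2)" for z :: complex
  proof -
    let ?x = "cmod z"
    \<comment> \<open>Completing the square; its constant term is the
      \<open>1 / (\<kappa> * s\<^sup>2)\<close> that appears in \<open>C\<close>.\<close>
    have "2 * ?x / s \<le> \<kappa> * ?x\<^sup>2 + 1 / (\<kappa> * s\<^sup>2)"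
    proof -
      have "0 \<le> \<kappa> * (?x - 1 / (\<kappa> * s))\<^sup>2"
        using \<kappa> by simp
      also have "\<dots> = \<kappa> * ?x\<^sup>2 + 1 / (\<kappa> * s\<^sup>2) - 2 * ?x / s"
        using \<kappa> s by (simp add: power2_eq_square field_simps)
      finally show ?thesis by simp
    qed
    moreover have "(?x / s + 1)\<^sup>2 - ?x\<^sup>2 = - 2 * \<kappa> * ?x\<^sup>2 + 2 * ?x / s + 1"
      using s by (simp add: \<kappa>_def power2_eq_square field_simps)
    ultimately have "(?x / s + 1)\<^sup>2 - ?x\<^sup>2 \<le> (1 + 1 / (\<kappa> * s\<^sup>2)) - \<kappa> * ?x\<^sup>2"
      by linarith
    then have "\<alpha> / 2 * ((?x / s + 1)\<^sup>2 - ?x\<^sup>2) \<le> \<alpha> / 2 * ((1 + 1 / (\<kappa> * s\<^sup>2)) - \<kappa> * ?x\<^sup>2)"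
      using \<alpha> by (intro mult_left_mono) auto
    then have "\<alpha> / 2 * (?x / s + 1)\<^sup>2 + - (\<alpha> / 2) * ?x\<^sup>2 \<le> \<alpha> / 2 * (1 + 1 / (\<kappa> * s\<^sup>2)) + - (\<alpha> / 2 * \<kappa>) * ?x\<^sup>2"
      by (simp add: algebra_simps)
    then have "exp (\<alpha> / 2 * (?x / s + 1)\<^sup>2) * exp (- (\<alpha> / 2) * ?x\<^sup>2)
        \<le> exp (\<alpha> / 2 * (1 + 1 / (\<kappa> * s\<^sup>2))) * exp (- (\<alpha> / 2 * \<kappa>) * ?x\<^sup>2)"
      unfolding exp_add[symmetric] by simp
    then have "\<bar>K\<bar> * (exp (\<alpha> / 2 * (?x / s + 1)\<^sup>2) * exp (- (\<alpha> / 2) * ?x\<^sup>2))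
        \<le> \<bar>K\<bar> * (exp (\<alpha> / 2 * (1 + 1 / (\<kappa> * s\<^sup>2))) * exp (- (\<alpha> / 2 * \<kappa>) * ?x\<^sup>2))"
      by (intro mult_left_mono) auto
    then have "(\<bar>K\<bar> * exp (\<alpha> / 2 * (?x / s + 1)\<^sup>2) * exp (- (\<alpha> / 2) * ?x\<^sup>2)) powr p
        \<le> (\<bar>K\<bar> * exp (\<alpha> / 2 * (1 + 1 / (\<kappa> * s\<^sup>2))) * exp (- (\<alpha> / 2 * \<kappa>) * ?x\<^sup>2)) powr p"
      using p by (intro powr_mono2) (auto simp: mult.assoc)
    also have "\<dots> = C * exp (- (\<alpha> / 2 * \<kappa>) * ?x\<^sup>2) powr p"
      by (simp add: C_def powr_mult)
    also have "exp (- (\<alpha> / 2 * \<kappa>) * ?x\<^sup>2) powr p = exp (- c * ?x\<^sup>2)"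
      by (simp add: powr_def c_def mult_ac)
    finally show ?thesis
      by (simp add: norm_mult)
  qed
  have "fock_integral p \<alpha> (\<lambda>z. of_real (K * exp (\<alpha> / 2 * (cmod z / s + 1)\<^sup>2)))
      \<le> (\<integral>\<^sup>+z. ennreal C * ennreal (exp (- c * (cmod (z::complex))\<^sup>2)) \<partial>lborel)"
    unfolding fock_integral_def using le
    by (intro nn_integral_mono) (auto simp: C_def ennreal_mult[symmetric])
  also have "\<dots> < \<infinity>"
    using nn_integral_complex_gaussian_finite[OF c]
    by (subst nn_integral_cmult) (auto simp: ennreal_mult_less_top)
  finally show ?thesis .
qed

text \<open>It places a merely pointwise limit of a bounded sequence in the space. Positivity of
  \<open>p\<close> gives continuity of the power at 0.\<close>

lemma fock_integral_Fatou:
  assumes [measurable]: "\<And>n. f n \<in> borel_measurable borel"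
    and lim: "\<And>z. (\<lambda>n. f n z) \<longlonglongrightarrow> g z" and le: "\<And>n. fock_integral p \<alpha> (f n) \<le> M" and p: "0 < p"
  shows "fock_integral p \<alpha> g \<le> M"
proof -
  let ?y = "\<lambda>f z. ennreal ((cmod (f z) * exp (- (\<alpha> / 2) * (cmod z)\<^sup>2)) powr p)"
  have "(\<lambda>n. ?y (f n) z) \<longlonglongrightarrow> ?y g z" for z
    using p by (intro tendsto_ennrealI tendsto_powr' tendsto_intros lim) auto
  then have "fock_integral p \<alpha> g = (\<integral>\<^sup>+z. liminf (\<lambda>n. ?y (f n) z) \<partial>lborel)"
    unfolding fock_integral_def by (intro nn_integral_cong) (metis lim_imp_Liminf trivial_limit_sequentially)
  also have "\<dots> \<le> liminf (\<lambda>n. fock_integral p \<alpha> (f n))"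
    unfolding fock_integral_def by (intro nn_integral_liminf) measurable
  also have "\<dots> \<le> limsup (\<lambda>n. fock_integral p \<alpha> (f n))"
    by (intro Liminf_le_Limsup) auto
  also have "\<dots> \<le> M"
    using le by (intro Limsup_bounded) auto
  finally show ?thesis .
qed

section \<open>Passage between the Fock norm and the Fock integral\<close>

lemma fock_norm_powr:
  assumes "0 < p"  "0 \<le> \<alpha>"
  shows "fock_norm p \<alpha> f powr p = \<alpha> * p / (2 * pi) * enn2real (fock_integral p \<alpha> f)"
  using assms by (simp add: fock_norm_def powr_powr)

lemma fock_integral_le_of_fock_norm_le:
  assumes p: "0 < p" and \<alpha>: "0 < \<alpha>" and f: "f \<in> fock_space p \<alpha>" "fock_norm p \<alpha> f \<le> M"
  shows "fock_integral p \<alpha> f \<le> ennreal (2 * pi / (\<alpha> * p) * M powr p)"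
proof -
  have "fock_norm p \<alpha> f powr p \<le> M powr p"
    using p f by (intro powr_mono2) (auto simp: fock_norm_def)
  then have "enn2real (fock_integral p \<alpha> f) \<le> 2 * pi / (\<alpha> * p) * M powr p"
    using p \<alpha> by (simp add: fock_norm_powr field_simps)
  moreover have "fock_integral p \<alpha> f = ennreal (enn2real (fock_integral p \<alpha> f))"
    using f by (simp add: fock_space_def)
  ultimately show ?thesis
    by (metis ennreal_leI)
qed

lemma fock_norm_tendsto_0I:
  assumes "(\<lambda>n. fock_integral p \<alpha> (f n)) \<longlonglongrightarrow> 0" "0 < p" "0 \<le> \<alpha>"
  shows "(\<lambda>n. fock_norm p \<alpha> (f n)) \<longlonglongrightarrow> 0"
proof -
  have "(\<lambda>n. enn2real (fock_integral p \<alpha> (f n))) \<longlonglongrightarrow> 0"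
    using assms(1) by (intro tendsto_enn2real) (simp_all only: ennreal_0 order_refl)
  then have "(\<lambda>n. \<alpha> * p / (2 * pi) * enn2real (fock_integral p \<alpha> (f n))) \<longlonglongrightarrow> \<alpha> * p / (2 * pi) * 0"
    by (intro tendsto_mult tendsto_const)
  then have "(\<lambda>n. fock_norm p \<alpha> (f n)) \<longlonglongrightarrow> (\<alpha> * p / (2 * pi) * 0) powr (1 / p)"
    unfolding fock_norm_def using assms by (intro tendsto_powr' tendsto_const) auto
  then show ?thesis
    by simp
qed

text \<open>The finiteness assumption guards against the default of \<open>enn2real\<close>, which
  sends infinity to 0: a function with infinite Fock integral has \<open>fock_norm\<close>
  0.\<close>

lemma fock_integral_tendsto_0I:
  assumes lim: "(\<lambda>n. fock_norm p \<alpha> (f n)) \<longlonglongrightarrow> 0" and p: "0 < p" "0 < \<alpha>"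
    and fin: "\<And>n. fock_integral p \<alpha> (f n) < \<infinity>"
  shows "(\<lambda>n. fock_integral p \<alpha> (f n)) \<longlonglongrightarrow> 0"
proof -
  have "(\<lambda>n. 2 * pi / (\<alpha> * p) * fock_norm p \<alpha> (f n) powr p) \<longlonglongrightarrow> 2 * pi / (\<alpha> * p) * 0 powr p"
    using p by (intro tendsto_mult tendsto_const tendsto_powr' lim) (auto simp: fock_norm_def)
  also have "(\<lambda>n. 2 * pi / (\<alpha> * p) * fock_norm p \<alpha> (f n) powr p) = (\<lambda>n. enn2real (fock_integral p \<alpha> (f n)))"
    using p by (simp add: fock_norm_powr)
  finally have "(\<lambda>n. ennreal (enn2real (fock_integral p \<alpha> (f n)))) \<longlonglongrightarrow> ennreal 0"
    by (intro tendsto_ennrealI) simp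
  then show ?thesis
    using fin by simp
qed

section \<open>Monomials in the Fock space\<close>

lemma power_div_fact_le_exp:
  fixes x :: real
  assumes "0 \<le> x"
  shows "x ^ n / fact n \<le> exp x"
proof -
  have "(\<lambda>n. x ^ n / fact n) sums exp x"
    using exp_converges[of x] by (simp add: divide_inverse mult.commute)
  then show ?thesis
    using sum_le_suminf[of "\<lambda>n. x ^ n / fact n" "{n}"] assms by (simp add: sums_iff)
qed

lemma fock_integral_power_finite:
  assumes p: "0 < p" and \<alpha>: "0 < \<alpha>"
  shows "fock_integral p \<alpha> (\<lambda>z. z ^ n) < \<infinity>"
proof -
  \<comment> \<open>The target is the slow growth bound with \<open>s = 2\<close>. With
    \<open>y = cmod z / 2 + 1\<close> one has \<open>cmod z <= 2 * y\<close> and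
    \<open>y ^ n <= (y\<^sup>2) ^ n\<close>; the remaining factors of \<open>K\<close> turn
    \<open>(y\<^sup>2) ^ n\<close> into a single term of the series of
    \<open>exp (\<alpha> / 2 * y\<^sup>2)\<close>.\<close>
  define K where "K = 2 ^ n * (2 / \<alpha>) ^ n * fact n"
  have "cmod (z ^ n) \<le> K * exp (\<alpha> / 2 * (cmod z / 2 + 1)\<^sup>2)" for z :: complex
  proof -
    define y where "y = cmod z / 2 + 1"
    have y: "1 \<le> y" "cmod z \<le> 2 * y"
      by (auto simp: y_def)
    have "cmod (z ^ n) \<le> (2 * y) ^ n"
      unfolding norm_power using y by (intro power_mono) auto
    also have "\<dots> \<le> 2 ^ n * (y\<^sup>2) ^ n"
      unfolding power_mult_distrib using y by (intro mult_left_mono power_mono) (auto simp: self_le_power)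
    also have "\<dots> = K * ((\<alpha> / 2 * y\<^sup>2) ^ n / fact n)"
      using \<alpha> by (simp add: K_def power_mult_distrib power_divide)
    also have "\<dots> \<le> K * exp (\<alpha> / 2 * y\<^sup>2)"
      using \<alpha> by (intro mult_left_mono power_div_fact_le_exp) (auto simp: K_def)
    finally show ?thesis
      by (simp add: y_def)
  qed
  moreover have "0 \<le> K"
    using \<alpha> by (simp add: K_def)
  ultimately have "fock_integral p \<alpha> (\<lambda>z. z ^ n)
      \<le> fock_integral p \<alpha> (\<lambda>z. of_real (K * exp (\<alpha> / 2 * (cmod z / 2 + 1)\<^sup>2)))"
    using p by (intro fock_integral_mono) (auto simp: norm_mult)
  also have "\<dots> < \<infinity>"
    using p \<alpha> by (intro fock_integral_slow_growth_finite) auto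
  finally show ?thesis .
qed

text \<open>The integrand vanishes at most at the origin, a null set. Positivity allows the
  monomials to be normalised.\<close>

lemma fock_integral_power_pos: "0 < fock_integral p \<alpha> (\<lambda>z. z ^ n)"
proof (rule ccontr)
  assume "\<not> 0 < fock_integral p \<alpha> (\<lambda>z. z ^ n)"
  then have "AE z in lborel. ennreal ((cmod (z ^ n) * exp (- (\<alpha> / 2) * (cmod z)\<^sup>2)) powr p) = 0"
    unfolding fock_integral_def by (subst nn_integral_0_iff_AE[symmetric]) auto
  moreover have "AE z in lborel. z \<noteq> (0::complex)"
    by (rule AE_lborel_singleton)
  ultimately have "AE z in (lborel :: complex measure). False"
    by eventually_elim simp
  then show False
    by (simp add: AE_iff_measurable[OF _ refl])
qed

text \<open>A rotation with \<open>u ^ (n - m) = - 1\<close> reverses the sign of the second monomial relative to the first.\<close>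

lemma fock_integral_power_le_diff:
  assumes p: "0 \<le> p" and mn: "m < n"
  shows "fock_integral p \<alpha> (\<lambda>z. 2 * b * z ^ m)
    \<le> ennreal (2 powr p) * (2 * fock_integral p \<alpha> (\<lambda>z. b * z ^ m - c * z ^ n))"
proof -
  define F where "F z = b * z ^ m - c * z ^ n" for z
  define u where "u = cis (pi / real (n - m))"
  \<comment> \<open>The phase that undoes the effect of the rotation on \<open>z ^ m\<close>. Then
    \<open>F z + v * F (u * z)\<close> doubles the first monomial and cancels the second, while both
    summands have the same Fock integral.\<close>
  define v where "v = inverse u ^ m"
  have [measurable]: "F \<in> borel_measurable borel"
    unfolding F_def by measurable
  have u: "cmod u = 1" "u \<noteq> 0" and v: "cmod v = 1"
    by (auto simp: u_def v_def norm_power norm_inverse)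
  have "u ^ (n - m) = -1"
  proof -
    have "u ^ (n - m) = cis (real (n - m) * (pi / real (n - m)))"
      unfolding u_def by (rule Complex.DeMoivre)
    also have "real (n - m) * (pi / real (n - m)) = pi"
      using mn by simp
    finally show ?thesis
      by simp
  qed
  then have un: "u ^ n = - (u ^ m)"
    using power_add[of u "n - m" m] mn by simp
  have "2 * b * z ^ m = F z + v * F (u * z)" for z
  proof -
    have "v * F (u * z) = (v * u ^ m) * (b * z ^ m + c * z ^ n)"
      by (simp add: F_def power_mult_distrib un algebra_simps)
    also have "v * u ^ m = 1"
      using u by (simp add: v_def power_mult_distrib[symmetric])
    finally show ?thesis
      by (simp add: F_def)
  qed
  then have "fock_integral p \<alpha> (\<lambda>z. 2 * b * z ^ m) = fock_integral p \<alpha> (\<lambda>z. F z + v * F (u * z))"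
    by simp
  also have "\<dots> \<le> ennreal (2 powr p) * (fock_integral p \<alpha> F + fock_integral p \<alpha> (\<lambda>z. v * F (u * z)))"
    by (intro fock_integral_add_le p) measurable
  also have "fock_integral p \<alpha> (\<lambda>z. v * F (u * z)) = fock_integral p \<alpha> F"
  proof -
    have "fock_integral p \<alpha> (\<lambda>z. v * F (u * z)) = ennreal (cmod v powr p) * fock_integral p \<alpha> (\<lambda>z. F (u * z))"
      by (rule fock_integral_cmult) measurable
    also have "fock_integral p \<alpha> (\<lambda>z. F (u * z)) = fock_integral p \<alpha> F"
      by (rule fock_integral_rotate) (measurable, fact u)
    finally show ?thesis
      unfolding v by simp
  qed
  also have "fock_integral p \<alpha> F + fock_integral p \<alpha> F = 2 * fock_integral p \<alpha> F"
    by (rule mult_2[symmetric])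
  finally show ?thesis
    unfolding F_def[abs_def] .
qed

text \<open>The Hausdorff operator will be identified with the average over \<open>N\<close> only
  for arguments in the Fock space, where measurability is at hand.\<close>

lemma compact_on_fock_cong:
  assumes "\<And>f. f \<in> fock_space p \<alpha> \<Longrightarrow> S f = T f"
  shows "compact_on_fock p \<alpha> S \<longleftrightarrow> compact_on_fock p \<alpha> T"
proof -
  have "compact_on_fock p \<alpha> T'" if "compact_on_fock p \<alpha> S'" and eq: "\<And>f. f \<in> fock_space p \<alpha> \<Longrightarrow> S' f = T' f" for S' T'
    unfolding compact_on_fock_def
  proof (intro conjI ballI allI impI)
    fix f assume "f \<in> fock_space p \<alpha>"
    then show "T' f \<in> fock_space p \<alpha>"
      using that unfolding compact_on_fock_def by metis
  next
    fix fs :: "nat \<Rightarrow> complex \<Rightarrow> complex" and M assume fs: "\<forall>n. fs n \<in> fock_space p \<alpha> \<and> fock_norm p \<alpha> (fs n) \<le> M"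
    then have "S' (fs n) = T' (fs n)" for n
      using eq by simp
    moreover have "\<exists>r g. strict_mono r \<and> g \<in> fock_space p \<alpha> \<and> (\<lambda>n. fock_norm p \<alpha> (\<lambda>z. S' (fs (r n)) z - g z)) \<longlonglongrightarrow> 0"
      using that(1) fs unfolding compact_on_fock_def by blast
    ultimately show "\<exists>r g. strict_mono r \<and> g \<in> fock_space p \<alpha> \<and> (\<lambda>n. fock_norm p \<alpha> (\<lambda>z. T' (fs (r n)) z - g z)) \<longlonglongrightarrow> 0"
      by simp
  qed
  then show ?thesis
    using assms by metis
qed

section \<open>Averages of dilations\<close>

text \<open>A weak form of Hoelder's inequality: integrate \<open>u \<le> \<lambda> + \<lambda> powr (1 - p) * u powr p\<close>, where
  \<open>\<lambda>\<close> is half the mean of \<open>u\<close>.\<close>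

lemma (in finite_measure) integral_powr_le:
  fixes u :: "'a \<Rightarrow> real"
  assumes p: "1 \<le> p" and u: "integrable M u" "integrable M (\<lambda>x. u x powr p)" "\<And>x. 0 \<le> u x"
  shows "(\<integral>x. u x \<partial>M) powr p \<le> 2 powr p * measure M (space M) powr (p - 1) * (\<integral>x. u x powr p \<partial>M)"
proof -
  define A where "A = (\<integral>x. u x \<partial>M)"
  define B where "B = (\<integral>x. u x powr p \<partial>M)"
  define m where "m = measure M (space M)"
  have A: "A \<ge> 0" and B: "B \<ge> 0"
    using u by (auto simp: A_def B_def)
  show ?thesis
  proof (cases "A = 0")
    case True
    then show ?thesis
      using B p by (simp add: A_def[symmetric] B_def[symmetric])
  next
    case False
    then have A: "A > 0"
      using A by simp
    \<comment> \<open>On a null measure the mean \<open>A\<close> would be 0, the case already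
      settled; \<open>l\<close> below divides by \<open>m\<close>.\<close>
    have m: "m > 0"
    proof (rule ccontr)
      assume "\<not> m > 0"
      then have "m = 0"
        using measure_nonneg[of M "space M"] by (simp add: m_def)
      then have "emeasure M (space M) = 0"
        by (simp add: m_def emeasure_eq_measure)
      then have "A = 0"
        unfolding A_def by (intro integral_eq_zero_AE AE_I'[of "space M"]) (auto simp: null_sets_def)
      then show False
        using A by simp
    qed
    \<comment> \<open>Half of the mean, so that the constant \<open>l\<close> integrates to
      \<open>A / 2\<close> and is absorbed on the left-hand side.\<close>
    define l where "l = A / (2 * m)"
    have l: "l > 0"
      using A m by (simp add: l_def)
    have le: "u x \<le> l + l powr (1 - p) * u x powr p" for x
    proof (cases "u x \<le> l")
      case False
      \<comment> \<open>Above the level \<open>l\<close> the function is compared with its p-th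
        power: the quotient \<open>u powr (1 - p)\<close> is largest at the level itself.\<close>
      have "l powr (p - 1) \<le> u x powr (p - 1)"
        using False l p by (intro powr_mono2) auto
      then have "l powr (1 - p) * l powr (p - 1) \<le> l powr (1 - p) * u x powr (p - 1)"
        by (intro mult_left_mono) auto
      then have "1 \<le> l powr (1 - p) * u x powr (p - 1)"
        using l by (simp add: powr_add[symmetric])
      then have "u x * 1 \<le> u x * (l powr (1 - p) * u x powr (p - 1))"
        by (rule mult_left_mono) (rule u(3))
      also have "\<dots> = l powr (1 - p) * u x powr p"
        using False l by (simp add: powr_diff)
      finally show ?thesis
        using l by simp
    qed (simp add: add_increasing2)
    have "A \<le> (\<integral>x. l + l powr (1 - p) * u x powr p \<partial>M)"
      unfolding A_def using u le by (intro integral_mono) auto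
    also have "\<dots> = l * m + l powr (1 - p) * B"
      using u by (simp add: B_def m_def)
    also have "l * m = A / 2"
      using m by (simp add: l_def)
    finally have "A / 2 \<le> l powr (1 - p) * B"
      by simp
    then have "l powr (p - 1) * (A / 2) \<le> l powr (p - 1) * (l powr (1 - p) * B)"
      by (intro mult_left_mono) auto
    also have "\<dots> = B"
      using l by (simp add: mult.assoc[symmetric] powr_add[symmetric])
    finally have "m powr (p - 1) * (l powr (p - 1) * (A / 2)) \<le> m powr (p - 1) * B"
      by (intro mult_left_mono) auto
    moreover have "m powr (p - 1) * (l powr (p - 1) * (A / 2)) = (A / 2) powr p"
    proof -
      have "m powr (p - 1) * l powr (p - 1) = (A / 2) powr (p - 1)"
        using m A by (simp add: powr_mult[symmetric] l_def)
      then have "m powr (p - 1) * (l powr (p - 1) * (A / 2)) = (A / 2) powr (p - 1) * (A / 2) powr 1"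
        using A by (simp add: mult.assoc[symmetric])
      also have "\<dots> = (A / 2) powr p"
        by (simp only: powr_add[symmetric]) simp
      finally show ?thesis .
    qed
    ultimately have "(A / 2) powr p \<le> m powr (p - 1) * B"
      by simp
    then show ?thesis
      using A by (simp add: powr_divide A_def[symmetric] B_def[symmetric] m_def[symmetric] field_simps)
  qed
qed

text \<open>A locale rather than one fixed measure, because the cut at \<open>s\<close> instantiates
  it again for the restrictions of \<open>N\<close> to \<open>{..<s}\<close> and
  \<open>{s..}\<close>.\<close>

locale dilation_measure = finite_measure N for N :: "real measure" +
  assumes sets_N: "sets N = sets borel" and AE_ge_1: "AE t in N. 1 \<le> t"
begin

lemma measurable_dilate_pair:
  assumes [measurable]: "f \<in> borel_measurable borel"
  shows "(\<lambda>(z, t). f (z / complex_of_real t)) \<in> borel_measurable (lborel \<Otimes>\<^sub>M N)"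
proof -
  have "(\<lambda>(z, t). f (z / complex_of_real t)) \<in> borel_measurable (borel \<Otimes>\<^sub>M borel)"
    by measurable
  moreover have "sets (lborel \<Otimes>\<^sub>M N) = sets (borel \<Otimes>\<^sub>M borel)"
    by (intro sets_pair_measure_cong sets_N) auto
  ultimately show ?thesis
    using measurable_cong_sets by blast
qed

lemma measurable_dilate [measurable (raw)]:
  assumes "f \<in> borel_measurable borel"
  shows "(\<lambda>t. f (z / complex_of_real t)) \<in> borel_measurable N"
  using measurable_compose[OF _ measurable_dilate_pair[OF assms], of "\<lambda>t. (z, t)" N] by simp

text \<open>For \<open>t\<close> at least 1 all points \<open>z / t\<close> lie in the closed disc
  of radius \<open>cmod z\<close>, where a continuous function is bounded, and \<open>N\<close> is
  finite. The codomain is general because real-valued moduli and their powers are needed as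
  well.\<close>

lemma integrable_dilate:
  fixes f :: "complex \<Rightarrow> 'b::{banach, second_countable_topology}"
  assumes "continuous_on UNIV f"
  shows "integrable N (\<lambda>t. f (z / complex_of_real t))"
proof -
  have "compact (f ` cball 0 (cmod z))"
    using assms by (intro compact_continuous_image) (auto intro: continuous_on_subset)
  then obtain B where "\<forall>w\<in>cball 0 (cmod z). norm (f w) \<le> B"
    by (auto dest!: compact_imp_bounded simp: bounded_iff)
  then have B: "norm (f w) \<le> B" if "cmod w \<le> cmod z" for w
    using that by simp
  show ?thesis
  proof (rule integrable_const_bound)
    show "AE t in N. norm (f (z / complex_of_real t)) \<le> B"
      using AE_ge_1 by eventually_elim (intro B norm_dilate_le)
  qed (use assms in \<open>auto intro!: measurable_dilate borel_measurable_continuous_onI\<close>)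
qed

text \<open>Averaging multiplies the n-th Taylor coefficient by the n-th moment \<open>c n\<close>
  of \<open>N\<close>. Since \<open>t >= 1\<close>, the termwise bound
  \<open>norm (a n * z ^ n)\<close> justifies exchanging sum and integral, and the result is again
  an everywhere convergent power series.\<close>

lemma holomorphic_integral_dilate:
  assumes hol: "f holomorphic_on UNIV"
  shows "(\<lambda>z. \<integral>t. f (z / complex_of_real t) \<partial>N) holomorphic_on UNIV"
proof -
  define a where "a n = (deriv ^^ n) f 0 / fact n" for n
  define c where "c n = (\<integral>t. (1 / complex_of_real t) ^ n \<partial>N)" for n
  have sums: "(\<lambda>n. a n * w ^ n) sums f w" for w
    using holomorphic_power_series[of f 0 "cmod w + 1" w] holomorphic_on_subset[OF hol]
    by (simp add: a_def)
  have abs: "summable (\<lambda>n. norm (a n * w ^ n))" for w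
  proof (rule powser_insidea)
    show "summable (\<lambda>n. a n * of_real (cmod w + 1) ^ n)"
      using sums sums_summable by blast
  qed auto
  have int: "integrable N (\<lambda>t. a n * (z / complex_of_real t) ^ n)" for n z
    by (rule integrable_dilate) (intro continuous_intros)
  have "(\<lambda>n. a n * c n * (z - 0) ^ n) sums (\<integral>t. f (z / complex_of_real t) \<partial>N)" for z
  proof -
    have "(\<lambda>n. \<integral>t. a n * (z / complex_of_real t) ^ n \<partial>N) sums (\<integral>t. (\<Sum>n. a n * (z / complex_of_real t) ^ n) \<partial>N)"
    proof (rule sums_integral[OF int])
      show "AE t in N. summable (\<lambda>n. norm (a n * (z / complex_of_real t) ^ n))"
        using abs by auto
      show "summable (\<lambda>n. \<integral>t. norm (a n * (z / complex_of_real t) ^ n) \<partial>N)"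
      proof (rule summable_comparison_test')
        show "summable (\<lambda>n. norm (a n * z ^ n) * measure N (space N))"
          by (intro summable_mult2 abs)
        show "norm (\<integral>t. norm (a n * (z / complex_of_real t) ^ n) \<partial>N) \<le> norm (a n * z ^ n) * measure N (space N)" for n
        proof -
          have "(\<integral>t. norm (a n * (z / complex_of_real t) ^ n) \<partial>N) \<le> (\<integral>t. norm (a n * z ^ n) \<partial>N)"
          proof (rule integral_mono_AE)
            show "AE t in N. norm (a n * (z / complex_of_real t) ^ n) \<le> norm (a n * z ^ n)"
              using AE_ge_1
            proof eventually_elim
              case (elim t)
              show ?case
                unfolding norm_mult norm_power
                by (intro mult_left_mono power_mono norm_dilate_le elim) auto
            qed
          qed (use int in auto)
          then show ?thesis
            by (simp add: mult.commute)
        qed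
      qed
    qed
    moreover have "(\<integral>t. a n * (z / complex_of_real t) ^ n \<partial>N) = a n * c n * (z - 0) ^ n" for n
    proof -
      have "(\<integral>t. a n * (z / complex_of_real t) ^ n \<partial>N) = (\<integral>t. (a n * z ^ n) * (1 / complex_of_real t) ^ n \<partial>N)"
        by (simp add: power_divide)
      also have "\<dots> = a n * c n * (z - 0) ^ n"
        unfolding c_def by (subst integral_mult_right_zero) simp
      finally show ?thesis .
    qed
    moreover have "(\<Sum>n. a n * w ^ n) = f w" for w
      by (rule sums_unique[symmetric, OF sums])
    ultimately show ?thesis
      by (simp only:)
  qed
  then have "(\<lambda>z. \<integral>t. f (z / complex_of_real t) \<partial>N) holomorphic_on ball 0 r" for r
    by (rule power_series_holomorphic)
  then have "(\<lambda>z. \<integral>t. f (z / complex_of_real t) \<partial>N) holomorphic_on (\<Union>n::nat. ball 0 (real n))"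
    by (intro holomorphic_on_UN_open) auto
  moreover have "(\<Union>n::nat. ball (0::complex) (real n)) = UNIV"
    using reals_Archimedean2 by auto
  ultimately show ?thesis
    by simp
qed

text \<open>A majorant of the average that, unlike the modulus of the average itself, is exactly
  additive when \<open>N\<close> is split. It is cast to a complex-valued function so that
  \<open>fock_integral\<close> applies, although it is not holomorphic in general.\<close>

definition mean_modulus :: "(complex \<Rightarrow> complex) \<Rightarrow> complex \<Rightarrow> complex" where
  "mean_modulus f z = of_real (\<integral>t. cmod (f (z / complex_of_real t)) \<partial>N)"

lemma measurable_mean_modulus:
  assumes "f \<in> borel_measurable borel"
  shows "mean_modulus f \<in> borel_measurable borel"
proof -
  have "(\<lambda>(z, t). cmod (f (z / complex_of_real t))) \<in> borel_measurable (lborel \<Otimes>\<^sub>M N)"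
    using measurable_dilate_pair[of "\<lambda>w. cmod (f w)"] assms by simp
  from borel_measurable_lebesgue_integral[OF this] show ?thesis
    unfolding mean_modulus_def by simp
qed

lemma norm_integral_dilate_le: "cmod (\<integral>t. f (z / complex_of_real t) \<partial>N) \<le> cmod (mean_modulus f z)"
  unfolding mean_modulus_def norm_of_real
  by (rule order_trans[OF integral_norm_bound abs_ge_self])

text \<open>The weak Hoelder inequality at each \<open>z\<close>, Tonelli, and the bound for a
  single dilation. Hoelder contributes the mass of \<open>N\<close> to the power
  \<open>p - 1\<close> and the integration over \<open>t\<close> one more factor. This positive
  power of the mass makes the part near \<open>t = 1\<close> small; \<open>s\<^sup>2\<close>
  confines the estimate to bounded \<open>t\<close>.\<close>

lemma fock_integral_mean_modulus_le:
  assumes p: "1 \<le> p" and \<alpha>: "0 \<le> \<alpha>" and f: "continuous_on UNIV f" and s: "AE t in N. t \<le> s"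
  shows "fock_integral p \<alpha> (mean_modulus f)
    \<le> ennreal (2 powr p * measure N (space N) powr p * s\<^sup>2) * fock_integral p \<alpha> f"
proof -
  let ?e = "\<lambda>z. exp (- (\<alpha> / 2) * (cmod z)\<^sup>2)"
  define m where "m = measure N (space N)"
  define C where "C = 2 powr p * m powr (p - 1)"
  interpret pair_sigma_finite lborel N ..
  have m: "m \<ge> 0"
    by (simp add: m_def)
  have [measurable]: "f \<in> borel_measurable borel"
    using f by (rule borel_measurable_continuous_onI)
  have [measurable]: "(\<lambda>(z, t). f (z / complex_of_real t)) \<in> borel_measurable (lborel \<Otimes>\<^sub>M N)"
    by (rule measurable_dilate_pair) fact
  have [measurable]: "(\<lambda>(z, t). ennreal ((cmod (f (z / complex_of_real t)) * ?e z) powr p)) \<in> borel_measurable (lborel \<Otimes>\<^sub>M N)"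
    by measurable
  have "ennreal ((cmod (mean_modulus f z) * ?e z) powr p)
      \<le> ennreal C * (\<integral>\<^sup>+t. ennreal ((cmod (f (z / complex_of_real t)) * ?e z) powr p) \<partial>N)" for z
  proof -
    have int: "integrable N (\<lambda>t. cmod (f (z / complex_of_real t)) * ?e z)"
      using f by (intro integrable_mult_left integrable_dilate[where f = "\<lambda>w. cmod (f w)"] continuous_intros)
    have "continuous_on UNIV (\<lambda>w. (cmod (f w) * ?e z) powr p)"
      using f p by (intro continuous_on_powr' continuous_intros) auto
    then have int': "integrable N (\<lambda>t. (cmod (f (z / complex_of_real t)) * ?e z) powr p)"
      by (rule integrable_dilate)
    have "(cmod (mean_modulus f z) * ?e z) powr p
        = (\<integral>t. cmod (f (z / complex_of_real t)) * ?e z \<partial>N) powr p"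
      by (simp add: mean_modulus_def)
    also have "\<dots> \<le> C * (\<integral>t. (cmod (f (z / complex_of_real t)) * ?e z) powr p \<partial>N)"
      unfolding C_def m_def by (rule integral_powr_le[OF p int int']) auto
    finally have "ennreal ((cmod (mean_modulus f z) * ?e z) powr p)
        \<le> ennreal C * ennreal (\<integral>t. (cmod (f (z / complex_of_real t)) * ?e z) powr p \<partial>N)"
      by (simp add: C_def ennreal_mult[symmetric])
    also have "ennreal (\<integral>t. (cmod (f (z / complex_of_real t)) * ?e z) powr p \<partial>N)
        = (\<integral>\<^sup>+t. ennreal ((cmod (f (z / complex_of_real t)) * ?e z) powr p) \<partial>N)"
      by (rule nn_integral_eq_integral[symmetric, OF int']) auto
    finally show ?thesis .
  qed
  then have "fock_integral p \<alpha> (mean_modulus f)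
      \<le> (\<integral>\<^sup>+z. ennreal C * (\<integral>\<^sup>+t. ennreal ((cmod (f (z / complex_of_real t)) * ?e z) powr p) \<partial>N) \<partial>lborel)"
    unfolding fock_integral_def by (rule nn_integral_mono)
  also have "\<dots> = ennreal C * (\<integral>\<^sup>+z. (\<integral>\<^sup>+t. ennreal ((cmod (f (z / complex_of_real t)) * ?e z) powr p) \<partial>N) \<partial>lborel)"
    by (intro nn_integral_cmult) measurable
  also have "(\<integral>\<^sup>+z. (\<integral>\<^sup>+t. ennreal ((cmod (f (z / complex_of_real t)) * ?e z) powr p) \<partial>N) \<partial>lborel)
      = (\<integral>\<^sup>+t. fock_integral p \<alpha> (\<lambda>z. f (z / complex_of_real t)) \<partial>N)"
    unfolding fock_integral_def by (rule Fubini'[symmetric]) measurable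
  also have "\<dots> \<le> (\<integral>\<^sup>+t. ennreal (s\<^sup>2) * fock_integral p \<alpha> f \<partial>N)"
  proof (rule nn_integral_mono_AE)
    show "AE t in N. fock_integral p \<alpha> (\<lambda>z. f (z / complex_of_real t)) \<le> ennreal (s\<^sup>2) * fock_integral p \<alpha> f"
      using AE_ge_1 s
    proof eventually_elim
      case (elim t)
      have "fock_integral p \<alpha> (\<lambda>z. f (z / complex_of_real t)) \<le> ennreal (t\<^sup>2) * fock_integral p \<alpha> f"
        using elim p \<alpha> by (intro fock_integral_dilate_le) auto
      also have "\<dots> \<le> ennreal (s\<^sup>2) * fock_integral p \<alpha> f"
        using elim by (intro mult_right_mono ennreal_leI power_mono) auto
      finally show ?case .
    qed
  qed
  also have "\<dots> = ennreal (s\<^sup>2) * fock_integral p \<alpha> f * ennreal m"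
    by (simp add: m_def emeasure_eq_measure)
  also have "ennreal C * (ennreal (s\<^sup>2) * fock_integral p \<alpha> f * ennreal m)
      = ennreal (2 powr p * m powr p * s\<^sup>2) * fock_integral p \<alpha> f"
  proof -
    have "C * m * s\<^sup>2 = 2 powr p * m powr p * s\<^sup>2"
      using m p by (cases "m = 0") (auto simp: C_def powr_diff)
    moreover have "ennreal (C * m * s\<^sup>2) = ennreal C * ennreal m * ennreal (s\<^sup>2)"
      using m by (simp add: C_def ennreal_mult)
    ultimately show ?thesis
      by (metis mult.assoc mult.commute)
  qed
  finally show ?thesis
    by (simp add: m_def mult_left_mono)
qed

text \<open>Points \<open>z / t\<close> with \<open>t >= s\<close> have modulus at most
  \<open>cmod z / s\<close>, so the growth bound of \<open>f\<close> is only met at that smaller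
  radius.\<close>

lemma mean_modulus_le_slow_growth:
  assumes f: "continuous_on UNIV f" "\<And>w. cmod (f w) \<le> K * exp (\<alpha> / 2 * (cmod w + 1)\<^sup>2)"
    and s: "AE t in N. s \<le> t" "0 < s" and "0 \<le> \<alpha>" "0 \<le> K"
  shows "cmod (mean_modulus f z) \<le> K * measure N (space N) * exp (\<alpha> / 2 * (cmod z / s + 1)\<^sup>2)"
proof -
  have "cmod (mean_modulus f z) = (\<integral>t. cmod (f (z / complex_of_real t)) \<partial>N)"
    by (simp add: mean_modulus_def)
  also have "\<dots> \<le> (\<integral>t. K * exp (\<alpha> / 2 * (cmod z / s + 1)\<^sup>2) \<partial>N)"
  proof (rule integral_mono_AE)
    show "integrable N (\<lambda>t. cmod (f (z / complex_of_real t)))"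
      using f by (intro integrable_norm integrable_dilate)
    show "AE t in N. cmod (f (z / complex_of_real t)) \<le> K * exp (\<alpha> / 2 * (cmod z / s + 1)\<^sup>2)"
      using s(1)
    proof eventually_elim
      case (elim t)
      have "cmod (f (z / complex_of_real t)) \<le> K * exp (\<alpha> / 2 * (cmod (z / complex_of_real t) + 1)\<^sup>2)"
        by (rule f)
      also have "\<dots> \<le> K * exp (\<alpha> / 2 * (cmod z / s + 1)\<^sup>2)"
        using assms elim by (auto intro!: mult_left_mono power_mono divide_left_mono simp: norm_divide)
      finally show ?case .
    qed
  qed simp
  also have "\<dots> = K * measure N (space N) * exp (\<alpha> / 2 * (cmod z / s + 1)\<^sup>2)"
    by simp
  finally show ?thesis .
qed

text \<open>Dominated convergence twice: over \<open>t\<close> for fixed \<open>z\<close>, where the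
  bound at radius \<open>cmod z\<close> is a constant majorant, and then over \<open>z\<close>,
  where the majorant \<open>G\<close> is integrable because \<open>s > 1\<close>.\<close>

lemma fock_integral_mean_modulus_tendsto_0:
  assumes p: "0 < p" and \<alpha>: "0 < \<alpha>" and f: "\<And>n. continuous_on UNIV (f n)"
    and bound: "\<And>n w. cmod (f n w) \<le> K * exp (\<alpha> / 2 * (cmod w + 1)\<^sup>2)" and K: "0 \<le> K"
    and lim: "\<And>w. (\<lambda>n. f n w) \<longlonglongrightarrow> 0"
    and s: "AE t in N. s \<le> t" "1 < s"
  shows "(\<lambda>n. fock_integral p \<alpha> (mean_modulus (f n))) \<longlonglongrightarrow> 0"
proof -
  let ?y = "\<lambda>f z. ennreal ((cmod (f z) * exp (- (\<alpha> / 2) * (cmod z)\<^sup>2)) powr p)"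
  define G where "G z = complex_of_real (K * measure N (space N) * exp (\<alpha> / 2 * (cmod z / s + 1)\<^sup>2))" for z
  have [measurable]: "G \<in> borel_measurable borel"
    unfolding G_def by measurable
  have meas [measurable]: "f n \<in> borel_measurable borel" for n
    using f by (rule borel_measurable_continuous_onI)
  have [measurable]: "mean_modulus (f n) \<in> borel_measurable borel" for n
    by (rule measurable_mean_modulus) fact
  have le: "cmod (mean_modulus (f n) z) \<le> cmod (G z)" for n z
    using mean_modulus_le_slow_growth[OF f bound s(1), of n z] s \<alpha> K by (simp add: G_def norm_mult)
  have "(\<lambda>n. mean_modulus (f n) z) \<longlonglongrightarrow> 0" for z
  proof -
    have "(\<lambda>n. \<integral>t. cmod (f n (z / complex_of_real t)) \<partial>N) \<longlonglongrightarrow> (\<integral>t. 0 \<partial>N)"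
    proof (rule integral_dominated_convergence)
      show "AE t in N. (\<lambda>n. cmod (f n (z / complex_of_real t))) \<longlonglongrightarrow> 0"
        using tendsto_norm_zero[OF lim] by auto
      show "AE t in N. norm (cmod (f n (z / complex_of_real t))) \<le> K * exp (\<alpha> / 2 * (cmod z + 1)\<^sup>2)" for n
        using AE_ge_1
      proof eventually_elim
        case (elim t)
        have "cmod (f n (z / complex_of_real t)) \<le> K * exp (\<alpha> / 2 * (cmod (z / complex_of_real t) + 1)\<^sup>2)"
          by (rule bound)
        also have "\<dots> \<le> K * exp (\<alpha> / 2 * (cmod z + 1)\<^sup>2)"
          using norm_dilate_le[OF elim, of z] K \<alpha> by (auto intro!: mult_left_mono power_mono simp del: norm_divide)
        finally show ?case by simp
      qed
      show "(\<lambda>t. cmod (f n (z / complex_of_real t))) \<in> borel_measurable N" for n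
        by (rule measurable_dilate) measurable
    qed auto
    then show ?thesis
      unfolding mean_modulus_def by (intro tendsto_of_real[where a = "0::real", simplified]) simp
  qed
  then have "(\<lambda>n. ?y (mean_modulus (f n)) z) \<longlonglongrightarrow> ennreal ((cmod 0 * exp (- (\<alpha> / 2) * (cmod z)\<^sup>2)) powr p)" for z
    using p by (intro tendsto_ennrealI tendsto_powr' tendsto_intros) auto
  then have "(\<lambda>n. fock_integral p \<alpha> (mean_modulus (f n))) \<longlonglongrightarrow> (\<integral>\<^sup>+z. 0 \<partial>(lborel :: complex measure))"
    unfolding fock_integral_def
  proof (intro nn_integral_dominated_convergence[where w = "?y G"])
    show "AE z in lborel. ?y (mean_modulus (f n)) z \<le> ?y G z" for n
      using le p by (intro AE_I2 ennreal_leI powr_mono2 mult_right_mono) auto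
    show "(\<integral>\<^sup>+z. ?y G z \<partial>lborel) < \<infinity>"
      using fock_integral_slow_growth_finite[OF p \<alpha> s(2)] unfolding fock_integral_def G_def .
  qed (use p in auto)
  then show ?thesis
    by simp
qed

section \<open>Splitting the measure; invariance of the Fock space\<close>

lemma dilation_measure_density_indicator:
  assumes A [measurable]: "A \<in> sets borel"
  shows "dilation_measure (density N (indicator A))"
proof -
  have [measurable]: "A \<in> sets N"
    by (simp add: sets_N)
  interpret D: finite_measure "density N (indicator A)"
    by (intro finite_measureI) (simp add: emeasure_restricted emeasure_eq_measure)
  show ?thesis
    using AE_ge_1 by unfold_locales (auto simp: sets_N AE_density)
qed

lemma fock_integral_dilate_split_le:
  assumes p: "0 \<le> p" and f: "continuous_on UNIV f"
  shows "fock_integral p \<alpha> (\<lambda>z. \<integral>t. f (z / complex_of_real t) \<partial>N) \<le> ennreal (2 powr p) *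
      (fock_integral p \<alpha> (dilation_measure.mean_modulus (density N (indicator {..<s})) f)
     + fock_integral p \<alpha> (dilation_measure.mean_modulus (density N (indicator {s..})) f))"
proof -
  interpret L: dilation_measure "density N (indicator {..<s})"
    by (rule dilation_measure_density_indicator) simp
  interpret R: dilation_measure "density N (indicator {s..})"
    by (rule dilation_measure_density_indicator) simp
  have fm: "f \<in> borel_measurable borel"
    using f by (rule borel_measurable_continuous_onI)
  have [measurable]: "{..<s} \<in> sets N" "{s..} \<in> sets N"
    by (simp_all add: sets_N)
  have "mean_modulus f z = L.mean_modulus f z + R.mean_modulus f z" for z
  proof -
    let ?u = "\<lambda>t. cmod (f (z / complex_of_real t))"
    have u: "integrable N ?u"
      using f by (intro integrable_norm integrable_dilate)
    have dens: "(\<integral>t. ?u t \<partial>density N (indicator A)) = (\<integral>t. indicator A t * ?u t \<partial>N)"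
      if [measurable]: "A \<in> sets N" for A
    proof -
      have "(\<integral>t. ?u t \<partial>density N (\<lambda>t. ennreal (indicator A t))) = (\<integral>t. indicator A t *\<^sub>R ?u t \<partial>N)"
        using u by (intro integral_density) auto
      then show ?thesis
        by (simp add: ennreal_indicator)
    qed
    have "(\<integral>t. ?u t \<partial>N) = (\<integral>t. indicator {..<s} t * ?u t + indicator {s..} t * ?u t \<partial>N)"
      by (intro Bochner_Integration.integral_cong) (auto split: split_indicator)
    also have "\<dots> = (\<integral>t. indicator {..<s} t * ?u t \<partial>N) + (\<integral>t. indicator {s..} t * ?u t \<partial>N)"
      using integrable_real_mult_indicator[OF _ u]
      by (intro Bochner_Integration.integral_add) (auto simp: mult.commute)
    finally show ?thesis
      by (simp add: mean_modulus_def L.mean_modulus_def R.mean_modulus_def dens)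
  qed
  then have "fock_integral p \<alpha> (\<lambda>z. \<integral>t. f (z / complex_of_real t) \<partial>N)
      \<le> fock_integral p \<alpha> (\<lambda>z. L.mean_modulus f z + R.mean_modulus f z)"
    using norm_integral_dilate_le[of f] by (intro fock_integral_mono[OF p]) auto
  also have "\<dots> \<le> ennreal (2 powr p) * (fock_integral p \<alpha> (L.mean_modulus f) + fock_integral p \<alpha> (R.mean_modulus f))"
    using p fm by (intro fock_integral_add_le L.measurable_mean_modulus R.measurable_mean_modulus)
  finally show ?thesis .
qed

lemma AE_density_indicator:
  assumes "A \<in> sets borel"
  shows "AE t in density N (indicator A). t \<in> A"
  using assms sets_N by (subst AE_density) (auto split: split_indicator)

text \<open>The cut at 2 is one choice of a number above 1: below it the dilations are uniformly
  bounded, above it the growth bound leaves a convergent Gaussian integral.\<close>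

lemma integral_dilate_in_fock_space:
  assumes p: "1 \<le> p" and \<alpha>: "0 < \<alpha>" and f: "f \<in> fock_space p \<alpha>"
  shows "(\<lambda>z. \<integral>t. f (z / complex_of_real t) \<partial>N) \<in> fock_space p \<alpha>"
proof -
  interpret L: dilation_measure "density N (indicator {..<2})"
    by (rule dilation_measure_density_indicator) simp
  interpret R: dilation_measure "density N (indicator {2..})"
    by (rule dilation_measure_density_indicator) simp
  have hol: "f holomorphic_on UNIV" and fin: "fock_integral p \<alpha> f < \<infinity>"
    using f by (auto simp: fock_space_def)
  have cont: "continuous_on UNIV f"
    using hol by (rule holomorphic_on_imp_continuous_on)
  have "AE t in density N (indicator {..<2}). t \<le> 2"
    using AE_density_indicator[of "{..<2}"] by (rule AE_mp) auto
  then have "fock_integral p \<alpha> (L.mean_modulus f) < \<infinity>"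
    using \<alpha> fin by (intro le_less_trans[OF L.fock_integral_mean_modulus_le[OF p _ cont]])
      (auto simp: ennreal_mult_less_top)
  moreover have "fock_integral p \<alpha> (R.mean_modulus f) < \<infinity>"
  proof -
    define K where "K = 1 + enn2real (fock_integral p \<alpha> f) / measure lborel (ball (0::complex) 1)"
    have K: "0 \<le> K"
      by (simp add: K_def)
    have "cmod (f w) \<le> K * exp (\<alpha> / 2 * (cmod w + 1)\<^sup>2)" for w
      using fock_space_pointwise_bound[OF p \<alpha> f, of w] by (simp add: K_def mult.commute)
    moreover have "AE t in density N (indicator {2..}). 2 \<le> t"
      using AE_density_indicator[of "{2..}"] by (rule AE_mp) auto
    ultimately have "fock_integral p \<alpha> (R.mean_modulus f) \<le> fock_integral p \<alpha>
        (\<lambda>z. of_real (K * measure (density N (indicator {2..})) (space (density N (indicator {2..}))) * exp (\<alpha> / 2 * (cmod z / 2 + 1)\<^sup>2)))"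
      using R.mean_modulus_le_slow_growth[OF cont, of K \<alpha> 2] K p \<alpha>
      by (intro fock_integral_mono) (auto simp: norm_mult)
    also have "\<dots> < \<infinity>"
      using p \<alpha> by (intro fock_integral_slow_growth_finite) auto
    finally show ?thesis .
  qed
  ultimately have "fock_integral p \<alpha> (\<lambda>z. \<integral>t. f (z / complex_of_real t) \<partial>N) < \<infinity>"
    using p by (intro le_less_trans[OF fock_integral_dilate_split_le[OF _ cont, where s = 2]])
      (auto simp: ennreal_mult_less_top)
  then show ?thesis
    using holomorphic_integral_dilate[OF hol] by (simp add: fock_space_def)
qed

section \<open>No mass at 1 implies compactness\<close>

lemma measure_lessThan_tendsto:
  "(\<lambda>k. measure N {..<1 + 1 / real (Suc k)}) \<longlonglongrightarrow> measure N {1}"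
proof -
  have "(\<lambda>k. measure N {..<1 + 1 / real (Suc k)}) \<longlonglongrightarrow> measure N (\<Inter>k. {..<1 + 1 / real (Suc k)})"
    by (rule finite_Lim_measure_decseq) (auto simp: sets_N decseq_def frac_le intro: order_less_le_trans)
  also have "(\<Inter>k. {..<1 + 1 / real (Suc k)}) = {..1}"
  proof (intro equalityI subsetI)
    fix x assume x: "x \<in> (\<Inter>k. {..<1 + 1 / real (Suc k)})"
    show "x \<in> {..1}"
    proof (rule ccontr)
      assume "x \<notin> {..1}"
      then obtain k where "inverse (real (Suc k)) < x - 1"
        using reals_Archimedean[of "x - 1"] by auto
      moreover have "x < 1 + 1 / real (Suc k)"
        using x by blast
      ultimately show False
        by (simp add: inverse_eq_divide)
    qed
  qed (auto intro: le_less_trans)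
  \<comment> \<open>The intersection is a half-line, but \<open>N\<close> does not charge its part
    below 1.\<close>
  also have "measure N {..1} = measure N {1}"
    using AE_ge_1 by (intro finite_measure_eq_AE) (auto simp: sets_N)
  finally show ?thesis .
qed

text \<open>The order of limits matters: for a fixed cut \<open>s k\<close> the far part vanishes as
  \<open>n\<close> grows while the near part is bounded by \<open>c k\<close> uniformly in
  \<open>n\<close>; only then does \<open>k\<close> tend to infinity.\<close>

lemma fock_integral_dilate_tendsto_0:
  assumes p: "1 \<le> p" and \<alpha>: "0 < \<alpha>" and f: "\<And>n. f n \<in> fock_space p \<alpha>"
    and M: "\<And>n. fock_integral p \<alpha> (f n) \<le> ennreal M"
    and lim: "\<And>w. (\<lambda>n. f n w) \<longlonglongrightarrow> 0" and null: "measure N {1} = 0"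
  shows "(\<lambda>n. fock_integral p \<alpha> (\<lambda>z. \<integral>t. f n (z / complex_of_real t) \<partial>N)) \<longlonglongrightarrow> 0"
proof -
  define J where "J n = fock_integral p \<alpha> (\<lambda>z. \<integral>t. f n (z / complex_of_real t) \<partial>N)" for n
  define s where "s k = 1 + 1 / real (Suc k)" for k
  \<comment> \<open>The outer \<open>2 powr p\<close> comes from splitting, the rest is the estimate
    for bounded \<open>t\<close>, with \<open>2\<^sup>2\<close> because \<open>s k <= 2\<close>. The
    maximum covers negative \<open>M\<close>, for which \<open>ennreal M\<close> is 0.\<close>
  define c where "c k = 2 powr p * (2 powr p * measure N {..<s k} powr p * 2\<^sup>2 * max M 0)" for k
  have cont: "continuous_on UNIV (f n)" for n
    using f by (intro holomorphic_on_imp_continuous_on) (auto simp: fock_space_def)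
  define K where "K = 1 + max M 0 / measure lborel (ball (0::complex) 1)"
  have K: "0 \<le> K"
    by (simp add: K_def)
  have bound: "cmod (f n w) \<le> K * exp (\<alpha> / 2 * (cmod w + 1)\<^sup>2)" for n w
  proof -
    have "enn2real (fock_integral p \<alpha> (f n)) \<le> max M 0"
      using M[of n] by (intro enn2real_leI) (auto simp: max_def ennreal_neg split: if_splits)
    then have "1 + enn2real (fock_integral p \<alpha> (f n)) / measure lborel (ball (0::complex) 1) \<le> K"
      by (simp add: K_def divide_right_mono)
    then have "exp (\<alpha> / 2 * (cmod w + 1)\<^sup>2) * (1 + enn2real (fock_integral p \<alpha> (f n)) / measure lborel (ball (0::complex) 1))
        \<le> K * exp (\<alpha> / 2 * (cmod w + 1)\<^sup>2)"
      unfolding mult.commute[of K] by (intro mult_left_mono) auto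
    with fock_space_pointwise_bound[OF p \<alpha> f, of n w] show ?thesis
      by (rule order_trans)
  qed
  have limsup: "limsup J \<le> ennreal (c k)" for k
  proof -
    interpret L: dilation_measure "density N (indicator {..<s k})"
      by (rule dilation_measure_density_indicator) simp
    interpret R: dilation_measure "density N (indicator {s k..})"
      by (rule dilation_measure_density_indicator) simp
    have s: "1 < s k" "s k \<le> 2"
      by (auto simp: s_def)
    have AE_L: "AE t in density N (indicator {..<s k}). t \<le> 2"
      using AE_density_indicator[of "{..<s k}"] s by (auto elim!: eventually_mono)
    have AE_R: "AE t in density N (indicator {s k..}). s k \<le> t"
      using AE_density_indicator[of "{s k..}"] by (auto elim!: eventually_mono)
    have mL: "measure (density N (indicator {..<s k})) (space (density N (indicator {..<s k}))) = measure N {..<s k}"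
    proof -
      have "space N = UNIV"
        using sets_eq_imp_space_eq[OF sets_N] by simp
      then show ?thesis
        by (simp add: measure_def emeasure_restricted sets_N)
    qed
    have "J n \<le> ennreal (c k) + ennreal (2 powr p) * fock_integral p \<alpha> (R.mean_modulus (f n))" for n
    proof -
      have "fock_integral p \<alpha> (L.mean_modulus (f n))
          \<le> ennreal (2 powr p * measure N {..<s k} powr p * 2\<^sup>2) * fock_integral p \<alpha> (f n)"
        using L.fock_integral_mean_modulus_le[OF p _ cont AE_L, of \<alpha> n] \<alpha> unfolding mL by simp
      also have "\<dots> \<le> ennreal (2 powr p * measure N {..<s k} powr p * 2\<^sup>2) * ennreal (max M 0)"
        using M[of n] by (intro mult_left_mono) (auto simp: max_def ennreal_neg split: if_splits)
      finally have "fock_integral p \<alpha> (L.mean_modulus (f n))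
          \<le> ennreal (2 powr p * measure N {..<s k} powr p * 2\<^sup>2 * max M 0)"
        by (simp add: ennreal_mult)
      then have "ennreal (2 powr p) * fock_integral p \<alpha> (L.mean_modulus (f n)) \<le> ennreal (c k)"
        unfolding c_def by (subst ennreal_mult) (auto intro!: mult_left_mono)
      then have "ennreal (2 powr p) * (fock_integral p \<alpha> (L.mean_modulus (f n)) + fock_integral p \<alpha> (R.mean_modulus (f n)))
          \<le> ennreal (c k) + ennreal (2 powr p) * fock_integral p \<alpha> (R.mean_modulus (f n))"
        unfolding distrib_left by (rule add_right_mono)
      moreover have "J n \<le> ennreal (2 powr p) * (fock_integral p \<alpha> (L.mean_modulus (f n)) + fock_integral p \<alpha> (R.mean_modulus (f n)))"
        unfolding J_def using p by (intro fock_integral_dilate_split_le cont) auto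
      ultimately show ?thesis
        by (rule order_trans[rotated])
    qed
    then have "limsup J \<le> limsup (\<lambda>n. ennreal (c k) + ennreal (2 powr p) * fock_integral p \<alpha> (R.mean_modulus (f n)))"
      by (intro Limsup_mono) auto
    also have "\<dots> = ennreal (c k) + ennreal (2 powr p) * 0"
    proof (intro lim_imp_Limsup tendsto_add tendsto_const ennreal_tendsto_cmult)
      show "(\<lambda>n. fock_integral p \<alpha> (R.mean_modulus (f n))) \<longlonglongrightarrow> 0"
        using p by (intro R.fock_integral_mean_modulus_tendsto_0[OF _ \<alpha> cont bound K lim AE_R s(1)]) auto
    qed auto
    finally show ?thesis
      by simp
  qed
  have "(\<lambda>k. ennreal (c k)) \<longlonglongrightarrow> ennreal (2 powr p * (2 powr p * 0 powr p * 2\<^sup>2 * max M 0))"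
    unfolding c_def s_def using p measure_lessThan_tendsto null
    by (intro tendsto_ennrealI tendsto_mult tendsto_const tendsto_powr') auto
  then have "limsup J \<le> 0"
    using limsup p by (intro tendsto_lowerbound[of "\<lambda>k. ennreal (c k)"]) auto
  then show ?thesis
    unfolding J_def[symmetric] by (intro tendsto_0_if_Limsup_eq_0_ennreal) simp
qed

lemma compact_on_fock_dilateI:
  assumes p: "1 \<le> p" and \<alpha>: "0 < \<alpha>" and null: "measure N {1} = 0"
  shows "compact_on_fock p \<alpha> (\<lambda>f z. \<integral>t. f (z / complex_of_real t) \<partial>N)"
  unfolding compact_on_fock_def
proof (intro conjI ballI allI impI)
  fix f assume "f \<in> fock_space p \<alpha>"
  then show "(\<lambda>z. \<integral>t. f (z / complex_of_real t) \<partial>N) \<in> fock_space p \<alpha>"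
    by (rule integral_dilate_in_fock_space[OF p \<alpha>])
next
  fix fs :: "nat \<Rightarrow> complex \<Rightarrow> complex" and M
  assume fs: "\<forall>n. fs n \<in> fock_space p \<alpha> \<and> fock_norm p \<alpha> (fs n) \<le> M"
  define C where "C = 2 * pi / (\<alpha> * p) * M powr p"
  have C: "0 \<le> C"
    using p \<alpha> by (simp add: C_def)
  have hol: "fs n holomorphic_on UNIV" and le: "fock_integral p \<alpha> (fs n) \<le> ennreal C" for n
    using fs p \<alpha> fock_integral_le_of_fock_norm_le[of p \<alpha> "fs n" M] by (auto simp: fock_space_def C_def)
  have bound: "cmod (fs n w) \<le> exp (\<alpha> / 2 * (R + 1)\<^sup>2) * (1 + C / measure lborel (ball (0::complex) 1))"
    if "cmod w \<le> R" for n w R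
  proof -
    have "enn2real (fock_integral p \<alpha> (fs n)) \<le> C"
      using le[of n] C by (intro enn2real_leI)
    then have "exp (\<alpha> / 2 * (cmod w + 1)\<^sup>2) * (1 + enn2real (fock_integral p \<alpha> (fs n)) / measure lborel (ball (0::complex) 1))
      \<le> exp (\<alpha> / 2 * (R + 1)\<^sup>2) * (1 + C / measure lborel (ball (0::complex) 1))"
      using \<alpha> that by (intro mult_mono) (auto intro!: mult_left_mono power_mono divide_right_mono)
    then show ?thesis
      using fock_space_pointwise_bound[OF p \<alpha>, of "fs n" w] fs by force
  qed
  obtain h r where h: "h holomorphic_on UNIV" and r: "strict_mono (r :: nat \<Rightarrow> nat)"
    and lim: "\<And>x. x \<in> UNIV \<Longrightarrow> (\<lambda>n. fs (r n) x) \<longlonglongrightarrow> h x"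
  proof (rule Montel[of UNIV "range fs" fs])
    show "\<exists>B. \<forall>h\<in>range fs. \<forall>z\<in>K. cmod (h z) \<le> B" if "compact K" for K
    proof -
      obtain R where "\<forall>z\<in>K. cmod z \<le> R"
        using compact_imp_bounded[OF \<open>compact K\<close>] by (auto simp: bounded_iff)
      then show ?thesis
        using bound by blast
    qed
  qed (use hol in auto)
  have meas: "fs n \<in> borel_measurable borel" "h \<in> borel_measurable borel" for n
    using hol h by (auto intro: entire_borel_measurable)
  \<comment> \<open>Montel yields only locally uniform convergence; the norm bound survives in the
    limit by Fatou.\<close>
  have h_le: "fock_integral p \<alpha> h \<le> ennreal C"
    using p by (intro fock_integral_Fatou[OF meas(1) lim le]) auto
  then have h_fock: "h \<in> fock_space p \<alpha>"
    using h le_less_trans[OF h_le] by (simp add: fock_space_def)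
  \<comment> \<open>By linearity the images converge to the image of \<open>h\<close> as soon as
    those of the differences tend to 0. The differences remain bounded and tend to 0
    pointwise.\<close>
  define \<phi> where "\<phi> n z = fs (r n) z - h z" for n z
  have \<phi>_le: "fock_integral p \<alpha> (\<phi> n) \<le> ennreal (2 powr p * (C + C))" for n
  proof -
    have "fock_integral p \<alpha> (\<phi> n) \<le> ennreal (2 powr p) * (fock_integral p \<alpha> (fs (r n)) + fock_integral p \<alpha> h)"
      unfolding \<phi>_def[abs_def] using p by (intro fock_integral_diff_le meas) auto
    also have "\<dots> \<le> ennreal (2 powr p) * (ennreal C + ennreal C)"
      by (intro mult_left_mono add_mono le h_le) auto
    also have "\<dots> = ennreal (2 powr p * (C + C))"
      by (simp only: ennreal_mult'[OF powr_ge_zero] ennreal_plus[OF C C])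
    finally show ?thesis .
  qed
  have \<phi>_fock: "\<phi> n \<in> fock_space p \<alpha>" for n
    using le_less_trans[OF \<phi>_le[of n]] hol[of "r n"] h
    by (auto simp: fock_space_def \<phi>_def[abs_def] intro!: holomorphic_intros)
  have "(\<lambda>n. fock_integral p \<alpha> (\<lambda>z. \<integral>t. \<phi> n (z / complex_of_real t) \<partial>N)) \<longlonglongrightarrow> 0"
  proof (rule fock_integral_dilate_tendsto_0[OF p \<alpha> \<phi>_fock \<phi>_le _ null])
    show "(\<lambda>n. \<phi> n w) \<longlonglongrightarrow> 0" for w
      unfolding \<phi>_def using tendsto_diff[OF lim[of w] tendsto_const[of "h w"]] by simp
  qed
  moreover have "(\<integral>t. \<phi> n (z / complex_of_real t) \<partial>N)
      = (\<integral>t. fs (r n) (z / complex_of_real t) \<partial>N) - (\<integral>t. h (z / complex_of_real t) \<partial>N)" for n z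
    unfolding \<phi>_def
    using hol h by (intro Bochner_Integration.integral_diff integrable_dilate holomorphic_on_imp_continuous_on)
  ultimately have "(\<lambda>n. fock_norm p \<alpha> (\<lambda>z. (\<integral>t. fs (r n) (z / complex_of_real t) \<partial>N)
      - (\<integral>t. h (z / complex_of_real t) \<partial>N))) \<longlonglongrightarrow> 0"
    using p \<alpha> by (intro fock_norm_tendsto_0I) auto
  then show "\<exists>r g. strict_mono r \<and> g \<in> fock_space p \<alpha> \<and>
      (\<lambda>n. fock_norm p \<alpha> (\<lambda>z. (\<integral>t. fs (r n) (z / complex_of_real t) \<partial>N) - g z)) \<longlonglongrightarrow> 0"
    using r integral_dilate_in_fock_space[OF p \<alpha> h_fock]
    by (intro exI[of _ r] exI[of _ "\<lambda>z. \<integral>t. h (z / complex_of_real t) \<partial>N"]) auto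
qed

section \<open>Compactness excludes mass at 1\<close>

lemma integrable_inverse_power: "integrable N (\<lambda>t. (1 / t) ^ n)"
proof (rule integrable_const_bound)
  show "AE t in N. norm ((1 / t) ^ n) \<le> 1"
    using AE_ge_1 by eventually_elim (auto intro!: power_le_one simp: power_abs)
  have "(\<lambda>t::real. (1 / t) ^ n) \<in> borel_measurable borel"
    by measurable
  then show "(\<lambda>t. (1 / t) ^ n) \<in> borel_measurable N"
    using measurable_cong_sets[OF sets_N refl] by blast
qed

lemma integral_dilate_power:
  "(\<integral>t. c * (z / complex_of_real t) ^ n \<partial>N) = of_real (\<integral>t. (1 / t) ^ n \<partial>N) * (c * z ^ n)"
proof -
  have "(\<integral>t. c * (z / complex_of_real t) ^ n \<partial>N) = (\<integral>t. (c * z ^ n) * of_real ((1 / t) ^ n) \<partial>N)"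
    by (simp add: power_divide)
  then show ?thesis
    by (simp add: mult.commute del: of_real_power)
qed

text \<open>The integrand is nonnegative on \<open>t >= 1\<close> and equals 1 at
  \<open>t = 1\<close> for every \<open>n\<close>. The eigenvalues thus have a lower bound
  independent of \<open>n\<close>.\<close>

lemma measure_1_le_moment: "measure N {1} \<le> (\<integral>t. (1 / t) ^ n \<partial>N)"
proof -
  have "measure N {1} = (\<integral>t. indicator {1} t \<partial>N)"
    using sets_eq_imp_space_eq[OF sets_N] by (simp add: sets_N)
  also have "\<dots> \<le> (\<integral>t. (1 / t) ^ n \<partial>N)"
  proof (rule integral_mono_AE[OF _ integrable_inverse_power])
    show "AE t in N. indicator {1} t \<le> (1 / t) ^ n"
      using AE_ge_1 by eventually_elim (auto split: split_indicator)
  qed (simp add: sets_N emeasure_eq_measure)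
  finally show ?thesis .
qed

lemma measure_1_eq_0_if_compact_on_fock:
  assumes p: "1 \<le> p" and \<alpha>: "0 < \<alpha>"
    and compact: "compact_on_fock p \<alpha> (\<lambda>f z. \<integral>t. f (z / complex_of_real t) \<partial>N)"
  shows "measure N {1} = 0"
proof (rule ccontr)
  define d where "d = measure N {1}"
  assume "measure N {1} \<noteq> 0"
  then have d: "d > 0"
    by (simp add: d_def order_less_le)
  \<comment> \<open>Scales the monomial to Fock integral exactly 1. Its norm is then the constant
    \<open>(\<alpha> * p / (2 * pi)) powr (1 / p)\<close>, the same for all \<open>n\<close>, which
    is all that boundedness requires.\<close>
  define k where "k n = enn2real (fock_integral p \<alpha> (\<lambda>z. z ^ n)) powr (- 1 / p)" for n
  define e where "e n z = complex_of_real (k n) * z ^ n" for n z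
  define a where "a n = (\<integral>t. (1 / t) ^ n \<partial>N)" for n
  have p0: "0 < p"
    using p by simp
  have e_meas: "e n \<in> borel_measurable borel" for n
    unfolding e_def[abs_def] by measurable
  have e_1: "fock_integral p \<alpha> (e n) = 1" for n
  proof -
    obtain I where I: "fock_integral p \<alpha> (\<lambda>z. z ^ n) = ennreal I" "0 < I"
      using fock_integral_power_finite[OF p0 \<alpha>, of n] fock_integral_power_pos[of p \<alpha> n]
      by (cases "fock_integral p \<alpha> (\<lambda>z. z ^ n)") auto
    have "fock_integral p \<alpha> (e n) = ennreal (k n powr p) * ennreal I"
      unfolding e_def[abs_def] using I by (subst fock_integral_cmult) (auto simp: k_def)
    also have "\<dots> = ennreal (k n powr p * I)"
      using I by (simp add: ennreal_mult)
    also have "k n powr p * I = 1"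
    proof -
      have "k n powr p = I powr (- 1)"
        using I p0 by (simp add: k_def powr_powr del: powr_minus)
      then show ?thesis
        using I by (simp add: powr_minus)
    qed
    finally show ?thesis
      by simp
  qed
  have e_fock: "e n \<in> fock_space p \<alpha>" for n
    using e_1[of n] by (auto simp: fock_space_def e_def[abs_def] intro!: holomorphic_intros)
  have "\<forall>n. e n \<in> fock_space p \<alpha> \<and> fock_norm p \<alpha> (e n) \<le> (\<alpha> * p / (2 * pi)) powr (1 / p)"
    using e_fock e_1 by (simp add: fock_norm_def)
  then obtain r g where r: "strict_mono r" and g: "g \<in> fock_space p \<alpha>"
    and lim: "(\<lambda>n. fock_norm p \<alpha> (\<lambda>z. (\<integral>t. e (r n) (z / complex_of_real t) \<partial>N) - g z)) \<longlonglongrightarrow> 0"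
    using compact unfolding compact_on_fock_def by blast
  define h where "h n z = of_real (a (r n)) * e (r n) z" for n z
  have h: "(\<integral>t. e (r n) (z / complex_of_real t) \<partial>N) = h n z" for n z
    unfolding e_def h_def a_def by (rule integral_dilate_power)
  have h_fock: "h n \<in> fock_space p \<alpha>" for n
    using integral_dilate_in_fock_space[OF p \<alpha> e_fock] by (simp add: h[symmetric, abs_def])
  have meas: "h n \<in> borel_measurable borel" "g \<in> borel_measurable borel" for n
    using h_fock g by (auto simp: fock_space_def intro: entire_borel_measurable)
  define D where "D n = fock_integral p \<alpha> (\<lambda>z. h n z - g z)" for n
  \<comment> \<open>Needed to turn the convergence of norms into convergence of integrals, since an
    infinite integral would be invisible to \<open>fock_norm\<close>.\<close>
  have "D n < \<infinity>" for n
  proof -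
    have "D n \<le> ennreal (2 powr p) * (fock_integral p \<alpha> (h n) + fock_integral p \<alpha> g)"
      unfolding D_def using p0 by (intro fock_integral_diff_le meas) auto
    also have "\<dots> < \<infinity>"
      using h_fock[of n] g by (auto simp: fock_space_def ennreal_mult_less_top)
    finally show ?thesis .
  qed
  then have D_0: "D \<longlonglongrightarrow> 0"
    unfolding D_def[abs_def] using lim p0 \<alpha> by (intro fock_integral_tendsto_0I) (auto simp: h)
  \<comment> \<open>Consecutive images along the subsequence have different degrees, so rotation
    bounds their distance below by the size of the first, and thus by \<open>d\<close>. The triangle
    inequality through \<open>g\<close> bounds it above by \<open>D n + D (Suc n)\<close>, which
    tends to 0. The two factors \<open>2 powr p\<close> come from these two estimates.\<close>
  have "ennreal ((2 * d) powr p) \<le> ennreal (2 powr p) * (2 * (ennreal (2 powr p) * (D n + D (Suc n))))" for n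
  proof -
    have "ennreal ((2 * d) powr p) \<le> ennreal (cmod (2 * of_real (a (r n))) powr p) * fock_integral p \<alpha> (e (r n))"
      using d p0 measure_1_le_moment[of "r n"] e_1
      by (auto simp: a_def d_def norm_mult intro!: ennreal_leI powr_mono2)
    also have "\<dots> = fock_integral p \<alpha> (\<lambda>z. 2 * (of_real (a (r n)) * of_real (k (r n))) * z ^ r n)"
      by (subst fock_integral_cmult[symmetric, OF e_meas]) (simp add: e_def mult.assoc)
    also have "\<dots> \<le> ennreal (2 powr p) * (2 * fock_integral p \<alpha> (\<lambda>z. h n z - h (Suc n) z))"
      using fock_integral_power_le_diff[of p "r n" "r (Suc n)" \<alpha> "of_real (a (r n)) * of_real (k (r n))"
          "of_real (a (r (Suc n))) * of_real (k (r (Suc n)))"] p0 r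
      by (simp add: h_def e_def strict_mono_Suc_iff mult.assoc[symmetric])
    also have "\<dots> \<le> ennreal (2 powr p) * (2 * (ennreal (2 powr p) * (D n + D (Suc n))))"
    proof (intro mult_left_mono)
      have "fock_integral p \<alpha> (\<lambda>z. (h n z - g z) - (h (Suc n) z - g z)) \<le> ennreal (2 powr p) * (D n + D (Suc n))"
        unfolding D_def using p0 meas by (intro fock_integral_diff_le borel_measurable_diff) auto
      then show "fock_integral p \<alpha> (\<lambda>z. h n z - h (Suc n) z) \<le> ennreal (2 powr p) * (D n + D (Suc n))"
        by simp
    qed auto
    finally show ?thesis .
  qed
  moreover have "(\<lambda>n. ennreal (2 powr p) * (2 * (ennreal (2 powr p) * (D n + D (Suc n)))))
      \<longlonglongrightarrow> ennreal (2 powr p) * (2 * (ennreal (2 powr p) * (0 + 0)))"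
    using D_0 by (intro ennreal_tendsto_cmult tendsto_add LIMSEQ_Suc) auto
  ultimately have "ennreal ((2 * d) powr p) \<le> 0"
    by (intro tendsto_lowerbound[where F = sequentially]) auto
  then show False
    using d by simp
qed

text \<open>On \<open>t >= 1\<close> the powers of \<open>1 / t\<close> are bounded by 1 and
  converge to the indicator of 1. The limit always exists, so the moment condition amounts to the
  absence of an atom at 1.\<close>

lemma moments_tendsto: "(\<lambda>n. \<integral>\<^sup>+t. ennreal ((1 / t) ^ n) \<partial>N) \<longlonglongrightarrow> emeasure N {1}"
proof -
  have "(\<lambda>n. \<integral>\<^sup>+t. ennreal ((1 / t) ^ n) \<partial>N) \<longlonglongrightarrow> (\<integral>\<^sup>+t. indicator {1} t \<partial>N)"
  proof (rule nn_integral_dominated_convergence[where w = "\<lambda>_. 1"])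
    show "(\<lambda>t. ennreal ((1 / t) ^ n)) \<in> borel_measurable N" for n
      by (intro measurable_compose[OF borel_measurable_integrable[OF integrable_inverse_power]]) simp
    show "AE t in N. ennreal ((1 / t) ^ n) \<le> 1" for n
      using AE_ge_1 by eventually_elim (auto intro!: power_le_one)
    show "AE t in N. (\<lambda>n. ennreal ((1 / t) ^ n)) \<longlonglongrightarrow> indicator {1} t"
      using AE_ge_1
    proof eventually_elim
      case (elim t)
      show ?case
      proof (cases "t = 1")
        case False
        then have "(\<lambda>n. ennreal ((1 / t) ^ n)) \<longlonglongrightarrow> ennreal 0"
          using elim by (intro tendsto_ennrealI LIMSEQ_power_zero) auto
        then show ?thesis
          using False by simp
      qed simp
    qed
    show "indicator {1} \<in> borel_measurable N"
      by (intro borel_measurable_indicator) (simp add: sets_N)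
  qed (auto simp: emeasure_eq_measure)
  then show ?thesis
    by (simp add: sets_N)
qed

lemma compact_on_fock_dilate_iff:
  assumes "1 \<le> p" "0 < \<alpha>"
  shows "compact_on_fock p \<alpha> (\<lambda>f z. \<integral>t. f (z / complex_of_real t) \<partial>N)
    \<longleftrightarrow> (\<lambda>n. \<integral>\<^sup>+t. ennreal ((1 / t) ^ n) \<partial>N) \<longlonglongrightarrow> 0"
proof -
  have "(\<lambda>n. \<integral>\<^sup>+t. ennreal ((1 / t) ^ n) \<partial>N) \<longlonglongrightarrow> 0 \<longleftrightarrow> emeasure N {1} = 0"
    using moments_tendsto LIMSEQ_unique by metis
  then show ?thesis
    using compact_on_fock_dilateI[OF assms] measure_1_eq_0_if_compact_on_fock[OF assms]
    by (auto simp: emeasure_eq_measure)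
qed

end

section \<open>From the averaged operator back to the Hausdorff operator\<close>

theorem theorem3:
  fixes p \<alpha> :: real and \<mu> :: "real measure"
  assumes "1 < p" and "0 < \<alpha>"
    and "sets \<mu> = sets borel"
    and "emeasure \<mu> {..0} = 0"
    and "emeasure \<mu> {0<..<1} = 0"
    and "(SUP n::nat. \<integral>\<^sup>+ t\<in>{1..}. ennreal (t powr (- real (n + 1))) \<partial>\<mu>) < \<infinity>"
  shows "compact_on_fock p \<alpha> (hausdorff_op \<mu>) \<longleftrightarrow>
         (\<lambda>n. \<integral>\<^sup>+ t\<in>{1..}. ennreal (1 / t ^ (n + 1)) \<partial>\<mu>) \<longlonglongrightarrow> 0"
proof -
  \<comment> \<open>The indicator makes the density nonnegative everywhere; it agrees with
    \<open>1 / t\<close> almost everywhere because \<open>\<mu>\<close> is carried by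
    \<open>{1..}\<close>.\<close>
  define w where "w t = indicator {1..} t / t" for t :: real
  define N where "N = density \<mu> (\<lambda>t. ennreal (w t))"
  have w: "0 \<le> w t" for t
    by (auto simp: w_def split: split_indicator)
  have meas: "f \<in> borel_measurable \<mu> \<longleftrightarrow> f \<in> borel_measurable borel" for f :: "real \<Rightarrow> 'b::topological_space"
    using measurable_cong_sets[OF assms(3) refl] by blast
  have w_meas: "w \<in> borel_measurable \<mu>"
    unfolding meas w_def[abs_def] by measurable
  have AE_ge_1: "AE t in \<mu>. 1 \<le> t"
  proof (rule AE_I')
    show "{..0} \<union> {0<..<1} \<in> null_sets \<mu>"
      using assms by (intro null_sets.Un) (auto simp: null_sets_def)
  qed auto
  \<comment> \<open>The term \<open>n = 0\<close> of the supremum is the total mass of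
    \<open>N\<close>.\<close>
  have "(\<integral>\<^sup>+ t\<in>{1..}. ennreal (t powr (- real (0 + 1))) \<partial>\<mu>) < \<infinity>"
    using assms(6) by (rule le_less_trans[OF SUP_upper, rotated]) simp
  moreover have "ennreal (t powr (- real (0 + 1))) * indicator {1..} t = ennreal (w t)" for t
    by (auto simp: w_def powr_minus_divide split: split_indicator)
  ultimately have fin: "(\<integral>\<^sup>+ t. ennreal (w t) \<partial>\<mu>) < \<infinity>"
    by simp
  have "emeasure N (space N) = (\<integral>\<^sup>+ t. ennreal (w t) \<partial>\<mu>)"
    unfolding N_def using w_meas by (subst emeasure_density) (auto intro!: nn_integral_cong)
  with fin interpret N: finite_measure N
    by (intro finite_measureI) simp
  have "AE t in N. 1 \<le> t"
    unfolding N_def using w_meas AE_ge_1 by (subst AE_density) auto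
  then interpret N: dilation_measure N
    using assms(3) by unfold_locales (simp_all add: N_def)
  have "hausdorff_op \<mu> f = (\<lambda>z. \<integral>t. f (z / complex_of_real t) \<partial>N)" if "f \<in> fock_space p \<alpha>" for f
  proof
    fix z
    have [measurable]: "f \<in> borel_measurable borel"
      using that by (auto simp: fock_space_def intro: entire_borel_measurable)
    have fm: "(\<lambda>t. f (z / complex_of_real t)) \<in> borel_measurable \<mu>"
      unfolding meas by measurable
    have "(\<integral>t. f (z / complex_of_real t) \<partial>N) = (\<integral>t. w t *\<^sub>R f (z / complex_of_real t) \<partial>\<mu>)"
      unfolding N_def using w by (intro integral_density fm w_meas) auto
    also have "\<dots> = hausdorff_op \<mu> f z"
      unfolding hausdorff_op_def
    proof (rule integral_cong_AE)
      show "AE t in \<mu>. w t *\<^sub>R f (z / complex_of_real t) = f (z / complex_of_real t) / complex_of_real t"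
        using AE_ge_1 by eventually_elim (auto simp: w_def scaleR_conv_of_real)
      show "(\<lambda>t. w t *\<^sub>R f (z / complex_of_real t)) \<in> borel_measurable \<mu>"
        using w_meas fm by measurable
      show "(\<lambda>t. f (z / complex_of_real t) / complex_of_real t) \<in> borel_measurable \<mu>"
        unfolding meas by measurable
    qed
    finally show "hausdorff_op \<mu> f z = (\<integral>t. f (z / complex_of_real t) \<partial>N)" ..
  qed
  then have "compact_on_fock p \<alpha> (hausdorff_op \<mu>)
      \<longleftrightarrow> compact_on_fock p \<alpha> (\<lambda>f z. \<integral>t. f (z / complex_of_real t) \<partial>N)"
    by (rule compact_on_fock_cong)
  also have "\<dots> \<longleftrightarrow> (\<lambda>n. \<integral>\<^sup>+t. ennreal ((1 / t) ^ n) \<partial>N) \<longlonglongrightarrow> 0"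
    using assms by (intro N.compact_on_fock_dilate_iff) auto
  \<comment> \<open>The density supplies one factor \<open>1 / t\<close>, so the n-th moment of
    \<open>N\<close> carries the exponent \<open>n + 1\<close> over \<open>\<mu>\<close>.\<close>
  also have "(\<lambda>n. \<integral>\<^sup>+t. ennreal ((1 / t) ^ n) \<partial>N) = (\<lambda>n. \<integral>\<^sup>+ t\<in>{1..}. ennreal (1 / t ^ (n + 1)) \<partial>\<mu>)"
  proof
    fix n
    have "(\<lambda>t::real. ennreal ((1 / t) ^ n)) \<in> borel_measurable \<mu>"
      unfolding meas by measurable
    then have "(\<integral>\<^sup>+t. ennreal ((1 / t) ^ n) \<partial>N) = (\<integral>\<^sup>+t. ennreal (w t) * ennreal ((1 / t) ^ n) \<partial>\<mu>)"
      unfolding N_def using w_meas by (intro nn_integral_density) auto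
    also have "\<dots> = (\<integral>\<^sup>+ t\<in>{1..}. ennreal (1 / t ^ (n + 1)) \<partial>\<mu>)"
      by (intro nn_integral_cong)
        (auto simp: w_def ennreal_mult[symmetric] power_divide split: split_indicator)
    finally show "(\<integral>\<^sup>+t. ennreal ((1 / t) ^ n) \<partial>N) = (\<integral>\<^sup>+ t\<in>{1..}. ennreal (1 / t ^ (n + 1)) \<partial>\<mu>)" .
  qed
  finally show ?thesis .
qed

end
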